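(* Let $A$ be a closed symmetric linear relation in a Hilbert space $\mathfrak H$ with defect numbers $n_\pm(A)=p<\infty$, let $\mathfrak H_+\subset\mathfrak H\subset\mathfrak H_-$ be the rigging associated with $A$, let $\Pi=(\mathbb C^p,\Gamma_0,\Gamma_1)$ be a boundary triple for $A^*$ with $\Gamma=\mathrm{col}\{\Gamma_0,\Gamma_1\}$, $A_0=\ker\Gamma_0$, $\gamma$-field $\gamma(\cdot)$ and $\widehat\gamma(\cdot)$, and let $R_z^0=(A_0-zI)^{-1}$ and $\widetilde R_z^0=(R_{\bar z}^0)^{\langle*\rangle}$ for $z\in\rho(A_0)$. Then $\Gamma$ admits a continuation to a bounded mapping $\widehat\Gamma=\mathrm{col}\{\widehat\Gamma_0,\widehat\Gamma_1\}:A^{\langle*\rangle}\to\mathbb C^{2p}$ (where $A^{\langle*\rangle}$ carries the topology of $\mathfrak H\times\mathfrak H_-$) given, for $z\in\rho(A_0)$, by $$\widehat\Gamma_0\begin{bmatrix}\widetilde R_z^0\mathfrak f\\ \mathfrak f+z\widetilde R_z^0\mathfrak f\end{bmatrix}=0,\qquad \widehat\Gamma_1\begin{bmatrix}\widetilde R_z^0\mathfrak f\\ \mathfrak f+z\widetilde R_z^0\mathfrak f\end{bmatrix}=\gamma(\bar z)^{\langle*\rangle}\mathfrak f,\qquad \mathfrak f\in\mathfrak H_-,$$ $$\widehat\Gamma\,\widehat\gamma(z)u=\Gamma\,\widehat\gamma(z)u,\qquad u\in\mathbb C^p .$$ Moreover, $$\ker\widehat\Gamma_0=\mathbf A_0,\qquad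 \ker\widehat\Gamma_1\cap\ker\widehat\Gamma_0=\mathbf A .$$
   Context: Inner products are linear in the first argument. A linear relation $T$ in $\mathfrak H$ is a linear subspace of $\mathfrak H\times\mathfrak H$ (operators are identified with their graphs); $\mathrm{col}\{f,g\}$ denotes an element; $\mathrm{mul}\,T=\{g:\mathrm{col}\{0,g\}\in T\}$; $T^*=\{\mathrm{col}\{u,f\}:(f,v)=(u,g)\ \forall\,\mathrm{col}\{v,g\}\in T\}$; $T-zI=\{\mathrm{col}\{f,g-zf\}\}$; $\rho(T)$ is the set of $z$ with $\ker(T-zI)=\{0\}$, $\mathrm{ran}(T-zI)=\mathfrak H$. $A$ is symmetric if $A\subseteq A^*$. $\mathfrak N_z=\ker(A^*-zI)$, $\widehat{\mathfrak N}_z=\{\mathrm{col}\{f,zf\}:f\in\mathfrak N_z\}$; $n_\pm(A)=\dim\mathfrak N_z$ for $z\in\mathbb C_\pm$. Boundary triple for $A^*$: linear maps $\Gamma_0,\Gamma_1:A^*\to\mathbb C^p$ such that $(f',g)-(f,g')=(\Gamma_0\widehat g)^*(\Gamma_1\widehat f)-(\Gamma_1\widehat g)^*(\Gamma_0\widehat f)$ for all $\widehat f=\mathrm{col}\{f,f'\},\widehat g=\mathrm{col}\{g,g'\}\in A^*$ and $\mathrm{col}\{\Gamma_0,\Gamma_1\}:A^*\to\mathbb C^{2p}$ is surjective. $A_0=\ker\Gamma_0$ is a selfadjoint extension of $A$. For $z\in\rho(A_0)$: $\widehat\gamma(z)=(\Gamma_0\upharpoonright\widehat{\mathfrak N}_z)^{-1}$,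 and $\gamma(z)$ is the first component of $\widehat\gamma(z)$, so $\gamma(z):\mathbb C^p\to\mathfrak N_z$. Rigging associated with $A$: let $\mathfrak H_0=\overline{\mathrm{dom}\,A}$. $\mathfrak H_+=\mathrm{dom}\,A^*\oplus\mathrm{mul}\,A$ with norm $\|h_0+h_1\|_+^2=\|h_0\|^2+\|P_{\mathfrak H_0}h_0'\|^2+\|h_1\|^2$, where $h_0\in\mathrm{dom}\,A^*$, $h_1\in\mathrm{mul}\,A$, $\mathrm{col}\{h_0,h_0'\}\in A^*$ and $P_{\mathfrak H_0}$ is the orthogonal projection onto $\mathfrak H_0$ (the vector $P_{\mathfrak H_0}h_0'$ depends only on $h_0$). $\mathfrak H_-$ is the Hilbert space of bounded conjugate-linear functionals on $\mathfrak H_+$, $\langle\mathfrak f,h\rangle_{-,+}:=\mathfrak f(h)$; $f\in\mathfrak H$ is identified with $h\mapsto(f,h)_{\mathfrak H}$, so $\mathfrak H\subset\mathfrak H_-$. Adjoints: $R^0_{\bar z}\in\mathcal B(\mathfrak H,\mathfrak H_+)$ and $\widetilde R^0_z=(R^0_{\bar z})^{\langle*\rangle}\in\mathcal B(\mathfrak H_-,\mathfrak H)$ is defined by $(\widetilde R_z^0\mathfrak f,g)_{\mathfrak H}=\langle\mathfrak f,R^0_{\bar z}g\rangle_{-,+}$. $\gamma(\bar z)^{\langle*\rangle}\in\mathcal B(\mathfrak H_-,\mathbb C^p)$ is defined by $\xi^*(\gamma(\bar z)^{\langle*\rangle}\mathfrak f)=\langle\mathfrak f,\gamma(\bar z)\xi\rangle_{-,+}$.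 For a relation $B\in\{A^*,A_0,A\}$ consider the set of all $\mathrm{col}\{f,\mathfrak f'\}\in\mathfrak H\times\mathfrak H_-$ such that $\langle\mathfrak f',h\rangle_{-,+}=(f,h')_{\mathfrak H}$ for all $\mathrm{col}\{h,h'\}\in B$. This set is denoted $\mathbf A$ for $B=A^*$, $\mathbf A_0$ for $B=A_0$, and $A^{\langle*\rangle}$ for $B=A$; thus $\mathbf A\subset\mathbf A_0\subset A^{\langle*\rangle}$, and for $z\in\rho(A_0)$ one has $\mathbf A_0=\{\mathrm{col}\{\widetilde R_z^0\mathfrak f,\mathfrak f+z\widetilde R_z^0\mathfrak f\}:\mathfrak f\in\mathfrak H_-\}$ and $A^{\langle*\rangle}=\mathbf A_0\dotplus\widehat{\mathfrak N}_z$. *)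

theory Defs
  imports
    "HOL-Analysis.Analysis"
    "HOL-Library.Function_Algebras"
    "Jordan_Normal_Form.Matrix"
begin

section \<open>Complex Hilbert spaces\<close>

text \<open>
  The complex inner product is linear in the first argument.  Its real part is the real inner
  product of the superclass, so definiteness, the norm \<open>norm x = sqrt (inner x x)\<close>, the
  topology and completeness are inherited.  Neither separability nor nontriviality is assumed.
\<close>

class chilbert_space = real_inner + complete_space +
  fixes scaleC :: "complex \<Rightarrow> 'a \<Rightarrow> 'a"  (infixr \<open>*\<^sub>C\<close> 75)
    and cinner :: "'a \<Rightarrow> 'a \<Rightarrow> complex"
  assumes scaleC_add_right: "a *\<^sub>C (x + y) = a *\<^sub>C x + a *\<^sub>C y"
    and scaleC_add_left: "(a + b) *\<^sub>C x = a *\<^sub>C x + b *\<^sub>C x"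
    and scaleC_scaleC: "a *\<^sub>C (b *\<^sub>C x) = (a * b) *\<^sub>C x"
    and scaleR_scaleC: "scaleR r x = complex_of_real r *\<^sub>C x"
    and cinner_commute: "cinner x y = cnj (cinner y x)"
    and cinner_add_left: "cinner (x + y) z = cinner x z + cinner y z"
    and cinner_scaleC_left: "cinner (a *\<^sub>C x) y = a * cinner x y"
    and inner_eq_Re_cinner: "inner x y = Re (cinner x y)"

global_interpretation complex_vs: vector_space "scaleC :: complex \<Rightarrow> 'a \<Rightarrow> 'a::chilbert_space"
  defines csubspace = complex_vs.subspace
    and cspan = complex_vs.span
    and cdependent = complex_vs.dependent
proof
  fix a b :: complex and x y :: 'a
  show "a *\<^sub>C (x + y) = a *\<^sub>C x + a *\<^sub>C y" by (rule scaleC_add_right)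
  show "(a + b) *\<^sub>C x = a *\<^sub>C x + b *\<^sub>C x" by (rule scaleC_add_left)
  show "a *\<^sub>C (b *\<^sub>C x) = (a * b) *\<^sub>C x" by (rule scaleC_scaleC)
  show "1 *\<^sub>C x = x" using scaleR_scaleC[of 1 x] by simp
qed

instantiation prod :: (chilbert_space, chilbert_space) chilbert_space
begin

definition scaleC_prod_def: "c *\<^sub>C x = (c *\<^sub>C fst x, c *\<^sub>C snd x)"

definition cinner_prod_def: "cinner x y = cinner (fst x) (fst y) + cinner (snd x) (snd y)"

instance
proof
  fix a b :: complex and r :: real and x y z :: "'a \<times> 'b"
  show "a *\<^sub>C (x + y) = a *\<^sub>C x + a *\<^sub>C y"
    by (simp add: scaleC_prod_def scaleC_add_right)
  show "(a + b) *\<^sub>C x = a *\<^sub>C x + b *\<^sub>C x"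
    by (simp add: scaleC_prod_def scaleC_add_left)
  show "a *\<^sub>C (b *\<^sub>C x) = (a * b) *\<^sub>C x"
    by (simp add: scaleC_prod_def scaleC_scaleC)
  show "scaleR r x = complex_of_real r *\<^sub>C x"
    by (simp add: scaleC_prod_def scaleR_prod_def scaleR_scaleC)
  show "cinner x y = cnj (cinner y x)"
    using cinner_commute[of "fst x" "fst y"] cinner_commute[of "snd x" "snd y"]
    by (simp add: cinner_prod_def)
  show "cinner (x + y) z = cinner x z + cinner y z"
    by (simp add: cinner_prod_def cinner_add_left)
  show "cinner (a *\<^sub>C x) y = a * cinner x y"
    by (simp add: cinner_prod_def scaleC_prod_def cinner_scaleC_left distrib_left)
  show "inner x y = Re (cinner x y)"
    by (simp add: cinner_prod_def inner_prod_def inner_eq_Re_cinner)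
qed

end

text \<open>
  The library's \<open>dim\<close> returns 0 on infinite-dimensional spaces, hence a relational version.
\<close>

definition has_cdim :: "'a::chilbert_space set \<Rightarrow> nat \<Rightarrow> bool" where
  "has_cdim S n \<longleftrightarrow> (\<exists>B. finite B \<and> card B = n \<and> \<not> cdependent B \<and> cspan B = S)"

definition orth_proj :: "'a::chilbert_space set \<Rightarrow> 'a \<Rightarrow> 'a" where
  "orth_proj S x = (THE y. y \<in> S \<and> (\<forall>s\<in>S. cinner (x - y) s = 0))"

text \<open>
  The space \<open>\<complex>\<^sup>p\<close> is \<open>carrier_vec p\<close>, so that \<open>p = 0\<close> is allowed, and
  \<open>\<xi>\<^sup>* \<eta>\<close> is \<open>\<eta> \<bullet>c \<xi>\<close>.
\<close>

definition cvec_norm :: "complex Matrix.vec \<Rightarrow> real" where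
  "cvec_norm v = sqrt (Re (v \<bullet>c v))"

definition col_map :: "('x \<Rightarrow> complex Matrix.vec) \<Rightarrow> ('x \<Rightarrow> complex Matrix.vec) \<Rightarrow> 'x \<Rightarrow> complex Matrix.vec"
  where "col_map F G x = F x @\<^sub>v G x"

definition linear_map_on ::
  "(complex \<Rightarrow> 'x \<Rightarrow> 'x) \<Rightarrow> 'x::plus set \<Rightarrow> nat \<Rightarrow> ('x \<Rightarrow> complex Matrix.vec) \<Rightarrow> bool" where
  "linear_map_on sc S n F \<longleftrightarrow>
     (\<forall>x\<in>S. F x \<in> carrier_vec n) \<and>
     (\<forall>x\<in>S. \<forall>y\<in>S. F (x + y) = F x + F y) \<and>
     (\<forall>c. \<forall>x\<in>S. F (sc c x) = c \<cdot>\<^sub>v F x)"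


section \<open>Linear relations\<close>

type_synonym 'h linrel = "('h \<times> 'h) set"

definition linear_relation :: "'h::chilbert_space linrel \<Rightarrow> bool" where
  "linear_relation T \<longleftrightarrow> csubspace T"

definition rel_ker :: "'h::chilbert_space linrel \<Rightarrow> 'h set" where
  "rel_ker T = {f. (f, 0) \<in> T}"

definition rel_mul :: "'h::chilbert_space linrel \<Rightarrow> 'h set" where
  "rel_mul T = {g. (0, g) \<in> T}"

definition rel_adj :: "'h::chilbert_space linrel \<Rightarrow> 'h linrel" where
  "rel_adj T = {(u, f). \<forall>(v, g)\<in>T. cinner f v = cinner u g}"

definition rel_shift :: "'h::chilbert_space linrel \<Rightarrow> complex \<Rightarrow> 'h linrel" where
  "rel_shift T z = {(f, g - z *\<^sub>C f) | f g. (f, g) \<in> T}"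

definition resolvent_set :: "'h::chilbert_space linrel \<Rightarrow> complex set" where
  "resolvent_set T = {z. rel_ker (rel_shift T z) = {0} \<and> Range (rel_shift T z) = UNIV}"

text \<open>For \<open>z \<in> resolvent_set T\<close> the relation \<open>(T - z I)\<inverse>\<close> is the graph of an operator on the whole
  space; this is the operator.\<close>

definition resolvent :: "'h::chilbert_space linrel \<Rightarrow> complex \<Rightarrow> 'h \<Rightarrow> 'h" where
  "resolvent T z g = (THE f. (g, f) \<in> (rel_shift T z)\<inverse>)"

definition defect_space :: "'h::chilbert_space linrel \<Rightarrow> complex \<Rightarrow> 'h set" where
  "defect_space A z = rel_ker (rel_shift (rel_adj A) z)"

definition defect_graph :: "'h::chilbert_space linrel \<Rightarrow> complex \<Rightarrow> 'h linrel" where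
  "defect_graph A z = {(f, z *\<^sub>C f) | f. f \<in> defect_space A z}"

definition defect_numbers :: "'h::chilbert_space linrel \<Rightarrow> nat \<Rightarrow> nat \<Rightarrow> bool" where
  "defect_numbers A m n \<longleftrightarrow>
     (\<forall>z. Im z > 0 \<longrightarrow> has_cdim (defect_space A z) m) \<and>
     (\<forall>z. Im z < 0 \<longrightarrow> has_cdim (defect_space A z) n)"


section \<open>Boundary triples\<close>

definition boundary_triple :: "'h::chilbert_space linrel \<Rightarrow> nat \<Rightarrow>
    ('h \<times> 'h \<Rightarrow> complex Matrix.vec) \<Rightarrow> ('h \<times> 'h \<Rightarrow> complex Matrix.vec) \<Rightarrow> bool" where
  "boundary_triple A p \<Gamma>\<^sub>0 \<Gamma>\<^sub>1 \<longleftrightarrow>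
     linear_map_on scaleC (rel_adj A) p \<Gamma>\<^sub>0 \<and>
     linear_map_on scaleC (rel_adj A) p \<Gamma>\<^sub>1 \<and>
     (\<forall>(f, f')\<in>rel_adj A. \<forall>(g, g')\<in>rel_adj A.
        cinner f' g - cinner f g' =
          \<Gamma>\<^sub>1 (f, f') \<bullet>c \<Gamma>\<^sub>0 (g, g') - \<Gamma>\<^sub>0 (f, f') \<bullet>c \<Gamma>\<^sub>1 (g, g')) \<and>
     col_map \<Gamma>\<^sub>0 \<Gamma>\<^sub>1 ` rel_adj A = carrier_vec (2 * p)"

definition kernel_on :: "'x set \<Rightarrow> nat \<Rightarrow> ('x \<Rightarrow> complex Matrix.vec) \<Rightarrow> 'x set" where
  "kernel_on S n F = {x \<in> S. F x = 0\<^sub>v n}"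

definition gamma_hat :: "'h::chilbert_space linrel \<Rightarrow> ('h \<times> 'h \<Rightarrow> complex Matrix.vec) \<Rightarrow>
    complex \<Rightarrow> complex Matrix.vec \<Rightarrow> 'h \<times> 'h" where
  "gamma_hat A \<Gamma>\<^sub>0 z u = the_inv_into (defect_graph A z) \<Gamma>\<^sub>0 u"

definition gamma_field :: "'h::chilbert_space linrel \<Rightarrow> ('h \<times> 'h \<Rightarrow> complex Matrix.vec) \<Rightarrow>
    complex \<Rightarrow> complex Matrix.vec \<Rightarrow> 'h" where
  "gamma_field A \<Gamma>\<^sub>0 z u = fst (gamma_hat A \<Gamma>\<^sub>0 z u)"


section \<open>The rigging associated with a symmetric relation\<close>

definition rig_plus :: "'h::chilbert_space linrel \<Rightarrow> 'h set" where
  "rig_plus A = {h\<^sub>0 + h\<^sub>1 | h\<^sub>0 h\<^sub>1. h\<^sub>0 \<in> Domain (rel_adj A) \<and> h\<^sub>1 \<in> rel_mul A}"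

text \<open>The decomposition \<open>h = h\<^sub>0 + h\<^sub>1\<close> is unique, and the projection of \<open>h\<^sub>0'\<close> does not depend on the
  choice of \<open>h\<^sub>0'\<close>, so the value below is unique.\<close>

definition rig_plus_norm :: "'h::chilbert_space linrel \<Rightarrow> 'h \<Rightarrow> real" where
  "rig_plus_norm A h = (THE r. \<exists>h\<^sub>0 h\<^sub>0' h\<^sub>1.
     (h\<^sub>0, h\<^sub>0') \<in> rel_adj A \<and> h\<^sub>1 \<in> rel_mul A \<and> h = h\<^sub>0 + h\<^sub>1 \<and>
     r = sqrt ((norm h\<^sub>0)\<^sup>2 + (norm (orth_proj (closure (Domain A)) h\<^sub>0'))\<^sup>2 + (norm h\<^sub>1)\<^sup>2))"

text \<open>Functionals on \<open>rig_plus A\<close> are represented by functions on the whole space that vanish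
  outside \<open>rig_plus A\<close>, which makes the representation unique; addition is pointwise.\<close>

definition rig_minus :: "'h::chilbert_space linrel \<Rightarrow> ('h \<Rightarrow> complex) set" where
  "rig_minus A = {\<phi>.
     (\<forall>h\<in>rig_plus A. \<forall>k\<in>rig_plus A. \<phi> (h + k) = \<phi> h + \<phi> k) \<and>
     (\<forall>c. \<forall>h\<in>rig_plus A. \<phi> (c *\<^sub>C h) = cnj c * \<phi> h) \<and>
     (\<exists>C. \<forall>h\<in>rig_plus A. cmod (\<phi> h) \<le> C * rig_plus_norm A h) \<and>
     (\<forall>h. h \<notin> rig_plus A \<longrightarrow> \<phi> h = 0)}"

definition rig_minus_norm :: "'h::chilbert_space linrel \<Rightarrow> ('h \<Rightarrow> complex) \<Rightarrow> real" where
  "rig_minus_norm A \<phi> = (SUP h\<in>{h \<in> rig_plus A. rig_plus_norm A h \<le> 1}. cmod (\<phi> h))"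

definition rig_embed :: "'h::chilbert_space linrel \<Rightarrow> 'h \<Rightarrow> ('h \<Rightarrow> complex)" where
  "rig_embed A f = (\<lambda>h. if h \<in> rig_plus A then cinner f h else 0)"

definition rig_pair :: "'h::chilbert_space linrel \<Rightarrow> 'h \<times> 'h \<Rightarrow> 'h \<times> ('h \<Rightarrow> complex)" where
  "rig_pair A x = (fst x, rig_embed A (snd x))"

definition pair_scale :: "complex \<Rightarrow> 'h::chilbert_space \<times> ('h \<Rightarrow> complex) \<Rightarrow> 'h \<times> ('h \<Rightarrow> complex)"
  where "pair_scale c x = (c *\<^sub>C fst x, \<lambda>h. c * snd x h)"

definition pair_norm :: "'h::chilbert_space linrel \<Rightarrow> 'h \<times> ('h \<Rightarrow> complex) \<Rightarrow> real" where
  "pair_norm A x = sqrt ((norm (fst x))\<^sup>2 + (rig_minus_norm A (snd x))\<^sup>2)"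

text \<open>With \<open>B = rel_adj A\<close>, \<open>B = ker \<Gamma>\<^sub>0\<close> and \<open>B = A\<close> this gives, respectively, the relations
  \<open>\<^bold>A\<close>, \<open>\<^bold>A\<^sub>0\<close> and \<open>A\<^sup>\<langle>\<^sup>*\<^sup>\<rangle>\<close>.\<close>

definition rig_rel :: "'h::chilbert_space linrel \<Rightarrow> 'h linrel \<Rightarrow> ('h \<times> ('h \<Rightarrow> complex)) set" where
  "rig_rel A B = {(f, \<phi>). \<phi> \<in> rig_minus A \<and> (\<forall>(h, h')\<in>B. \<phi> h = cinner f h')}"

definition bounded_map_on_rel :: "'h::chilbert_space linrel \<Rightarrow> nat \<Rightarrow>
    ('h \<times> ('h \<Rightarrow> complex) \<Rightarrow> complex Matrix.vec) \<Rightarrow> bool" where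
  "bounded_map_on_rel A n F \<longleftrightarrow>
     linear_map_on pair_scale (rig_rel A A) n F \<and>
     (\<exists>C. \<forall>x\<in>rig_rel A A. cvec_norm (F x) \<le> C * pair_norm A x)"

text \<open>The extended resolvent is the adjoint of the resolvent at \<open>cnj z\<close> regarded as an operator
  into \<open>rig_plus A\<close>; likewise for the adjoint of the \<open>\<gamma>\<close>-field.\<close>

definition ext_resolvent ::
  "'h::chilbert_space linrel \<Rightarrow> complex \<Rightarrow> ('h \<Rightarrow> complex) \<Rightarrow> 'h" where
  "ext_resolvent A\<^sub>0 z \<phi> = (THE x. \<forall>g. cinner x g = \<phi> (resolvent A\<^sub>0 (cnj z) g))"

definition gamma_adj :: "'h::chilbert_space linrel \<Rightarrow> nat \<Rightarrow> ('h \<times> 'h \<Rightarrow> complex Matrix.vec) \<Rightarrow>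
    complex \<Rightarrow> ('h \<Rightarrow> complex) \<Rightarrow> complex Matrix.vec" where
  "gamma_adj A p \<Gamma>\<^sub>0 w \<phi> = (THE v. v \<in> carrier_vec p \<and>
     (\<forall>\<xi>\<in>carrier_vec p. v \<bullet>c \<xi> = \<phi> (gamma_field A \<Gamma>\<^sub>0 w \<xi>)))"

end

theory Submission
  imports Defs
begin

text \<open>
  A pair \<open>x = (f, \<phi>)\<close> defines the antilinear form \<open>\<phi> h - cinner f h'\<close> on \<open>rel_adj A\<close>, which vanishes
  on \<open>A\<close> exactly when \<open>x\<close> lies in the extended adjoint of \<open>A\<close>.  Green's identity and
  \<open>rel_adj (rel_adj A) = A\<close> show that \<open>A\<close> is the common kernel of the boundary maps, so
  this form factors through \<open>\<complex>\<^sup>2\<^sup>p\<close> and is represented there by a unique vector, written with the sign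
  pattern of Green's identity; its two components are the extended boundary maps.  Both kernels can
  be read off from this representation, and evaluating the form at finitely many fixed elements of
  \<open>rel_adj A\<close> gives boundedness.  For the resolvent formula one needs that \<open>A\<^sub>0 - cnj z\<close>
  has a bounded everywhere defined inverse, which follows from the uniform boundedness principle, and
  the extended resolvent then exists by the Riesz representation theorem.
\<close>

section \<open>Hilbert spaces\<close>

text \<open>A minimising sequence for the distance is Cauchy by the parallelogram law, closedness
  puts its limit in \<open>S\<close>, and minimality along each direction \<open>s\<close> forces
  orthogonality.\<close>

lemma closed_subspace_projection_exists:
  fixes S :: "'a::{real_inner, complete_space} set"
  assumes S: "subspace S" "closed S"
  shows "\<exists>y\<in>S. \<forall>s\<in>S. inner (x - y) s = 0"
proof -
  define d where "d = infdist x S"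
  have ne: "S \<noteq> {}" using subspace_0[OF S(1)] by auto
  have d_le: "d \<le> norm (x - y)" if "y \<in> S" for y
    using infdist_le[OF that, of x] by (simp add: d_def dist_norm)
  have d0: "0 \<le> d" by (simp add: d_def infdist_nonneg)
  have "\<exists>y\<in>S. (norm (x - y))\<^sup>2 < d\<^sup>2 + e" if "e > 0" for e
  proof (rule ccontr)
    assume "\<not> ?thesis"
    hence h: "sqrt (d\<^sup>2 + e) \<le> norm (x - y)" if "y \<in> S" for y
      using that by (auto intro: real_le_lsqrt simp: not_less)
    have "sqrt (d\<^sup>2 + e) \<le> d"
      unfolding d_def infdist_notempty[OF ne]
      by (rule cINF_greatest[OF ne]) (use h in \<open>simp add: d_def dist_norm infdist_notempty[OF ne]\<close>)
    hence "d\<^sup>2 + e \<le> d\<^sup>2" using d0 \<open>e > 0\<close> by (simp add: real_sqrt_le_iff' sqrt_le_D)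
    thus False using \<open>e > 0\<close> by simp
  qed
  hence "\<exists>y\<in>S. (norm (x - y))\<^sup>2 < d\<^sup>2 + 1 / real (Suc n)" for n by simp
  then obtain y where y: "\<And>n. y n \<in> S" "\<And>n. (norm (x - y n))\<^sup>2 < d\<^sup>2 + 1 / real (Suc n)"
    by metis
  have dist_y: "(norm (y m - y n))\<^sup>2 \<le> 2 / real (Suc m) + 2 / real (Suc n)" for m n
  proof -
    \<comment> \<open>Midpoints stay in \<open>S\<close>, hence at distance at least
      \<open>d\<close> from \<open>x\<close>; the parallelogram identity then leaves little room for
      \<open>norm (y m - y n)\<close>.\<close>
    have "(1/2) *\<^sub>R (y m + y n) \<in> S"
      using S(1) y(1) by (simp add: subspace_add subspace_scale)
    hence "d \<le> norm (x - (1/2) *\<^sub>R (y m + y n))" by (rule d_le)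
    hence "d\<^sup>2 \<le> (norm (x - (1/2) *\<^sub>R (y m + y n)))\<^sup>2" using d0 by simp
    moreover have "(norm (y m - y n))\<^sup>2 + 4 * (norm (x - (1/2) *\<^sub>R (y m + y n)))\<^sup>2 =
        2 * (norm (x - y m))\<^sup>2 + 2 * (norm (x - y n))\<^sup>2"
      unfolding power2_norm_eq_inner
      by (simp add: inner_diff_left inner_diff_right inner_add_left inner_add_right inner_commute
          algebra_simps)
    moreover have "2 / real (Suc k) = 2 * (1 / real (Suc k))" for k by simp
    ultimately show ?thesis using y(2)[of m] y(2)[of n] by linarith
  qed
  have "Cauchy y"
  proof (rule CauchyI)
    fix e :: real assume "e > 0"
    obtain N where N: "4 / e\<^sup>2 < real N" using reals_Archimedean2 by blast
    have N': "2 / real (Suc m) < e\<^sup>2 / 2" if "N \<le> m" for m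
    proof -
      have "4 / e\<^sup>2 < real (Suc m)" using N that by simp
      thus ?thesis using \<open>e > 0\<close> by (simp add: field_simps)
    qed
    have "norm (y m - y n) < e" if "N \<le> m" "N \<le> n" for m n
    proof -
      have "(norm (y m - y n))\<^sup>2 < e\<^sup>2"
        using dist_y[of m n] N'[OF that(1)] N'[OF that(2)] by simp
      thus ?thesis using \<open>e > 0\<close> by (simp add: power2_less_imp_less)
    qed
    thus "\<exists>M. \<forall>m\<ge>M. \<forall>n\<ge>M. norm (y m - y n) < e" by blast
  qed
  then obtain l where l: "y \<longlonglongrightarrow> l" using Cauchy_convergent convergent_def by blast
  have lS: "l \<in> S" using S(2) l y(1) closed_sequentially by blast
  have "(\<lambda>n. (norm (x - y n))\<^sup>2) \<longlonglongrightarrow> (norm (x - l))\<^sup>2"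
    by (intro tendsto_intros l)
  moreover have "(\<lambda>n. d\<^sup>2 + 1 / real (Suc n)) \<longlonglongrightarrow> d\<^sup>2 + 0"
    by (intro tendsto_intros LIMSEQ_Suc[OF lim_1_over_n])
  ultimately have min: "(norm (x - l))\<^sup>2 \<le> d\<^sup>2"
    using y(2) less_imp_le by (metis (no_types, lifting) LIMSEQ_le add.right_neutral)
  have "inner (x - l) s = 0" if "s \<in> S" for s
  proof (cases "s = 0")
    case False
    \<comment> \<open>This \<open>t\<close> minimises the squared norm of
      \<open>x - (l + t *\<^sub>R s)\<close>; a nonzero inner product would push it below the
      minimum.\<close>
    define t where "t = inner (x - l) s / (norm s)\<^sup>2"
    have "l + t *\<^sub>R s \<in> S" using S(1) lS that by (simp add: subspace_add subspace_scale)
    hence "d \<le> norm (x - (l + t *\<^sub>R s))" by (rule d_le)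
    hence "d\<^sup>2 \<le> (norm (x - (l + t *\<^sub>R s)))\<^sup>2" using d0 by simp
    also have "\<dots> = (norm (x - l))\<^sup>2 - 2 * t * inner (x - l) s + t\<^sup>2 * (norm s)\<^sup>2"
      unfolding power2_norm_eq_inner
      by (simp add: inner_diff_left inner_diff_right inner_add_left inner_add_right inner_commute
          algebra_simps power2_eq_square)
    also have "\<dots> = (norm (x - l))\<^sup>2 - (inner (x - l) s)\<^sup>2 / (norm s)\<^sup>2"
      using False by (simp add: t_def field_simps power2_eq_square)
    finally have "(inner (x - l) s)\<^sup>2 / (norm s)\<^sup>2 \<le> 0" using min by simp
    thus ?thesis using False by (simp add: divide_le_0_iff)
  qed simp
  with lS show ?thesis by blast
qed

text \<open>Uniform boundedness by Baire's theorem: the closed sets \<open>F n\<close> cover the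
  space, so one of them contains a ball, on which all functionals \<open>inner k\<close> share a
  bound.\<close>

lemma weakly_bounded_imp_bounded:
  fixes S :: "'a::{real_inner, complete_space} set"
  assumes "\<And>g. \<exists>M. \<forall>k\<in>S. \<bar>inner k g\<bar> \<le> M"
  shows "bounded S"
proof -
  define F where "F n = {g. \<forall>k\<in>S. \<bar>inner k g\<bar> \<le> real n}" for n
  have cl: "closed (F n)" for n
  proof -
    have "F n = (\<Inter>k\<in>S. {g. \<bar>inner k g\<bar> \<le> real n})" by (auto simp: F_def)
    thus ?thesis by (auto intro!: closed_INT closed_Collect_le continuous_intros)
  qed
  have "g \<in> \<Union>(range F)" for g
  proof -
    obtain M where "\<forall>k\<in>S. \<bar>inner k g\<bar> \<le> M" using assms by blast
    moreover obtain n where "M \<le> real n" using real_arch_simple by blast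
    ultimately have "g \<in> F n" unfolding F_def by fastforce
    thus ?thesis by blast
  qed
  hence un: "\<Union>(range F) = UNIV" by blast
  have "\<exists>n. interior (F n) \<noteq> {}"
  proof (rule ccontr)
    assume "\<not> ?thesis"
    hence "euclidean interior_of \<Union>(range F) = {}"
      by (intro Baire_category_alt) (use cl in \<open>auto simp: completely_metrizable_space_euclidean\<close>)
    thus False using un by simp
  qed
  then obtain n g0 r where r: "r > 0" "ball g0 r \<subseteq> F n"
    by (metis all_not_in_conv mem_interior)
  have "norm k \<le> 4 * real n / r" if "k \<in> S" for k
  proof (cases "k = 0")
    case False
    \<comment> \<open>This vector has length \<open>r / 2\<close> and the direction of
      \<open>k\<close>; \<open>g0\<close> and \<open>g0 + u\<close> both lie in the ball, and
      subtraction isolates \<open>inner k u\<close>.\<close>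
    define u where "u = (r / (2 * norm k)) *\<^sub>R k"
    have "norm u = r / 2" using False r(1) by (simp add: u_def)
    hence "g0 \<in> F n" "g0 + u \<in> F n" using r by (auto simp: dist_norm)
    hence "\<bar>inner k g0\<bar> \<le> real n" "\<bar>inner k (g0 + u)\<bar> \<le> real n" using that by (auto simp: F_def)
    hence "inner k u \<le> 2 * real n" by (simp add: inner_add_right)
    moreover have "inner k u = r / 2 * norm k"
      using False by (simp add: u_def dot_square_norm power2_eq_square)
    ultimately show ?thesis using r(1) by (simp add: field_simps)
  qed (use r in simp)
  thus ?thesis by (auto simp: bounded_iff)
qed

section \<open>Calculus of the complex inner product\<close>

lemma cinner_add_right: "cinner x (y + z) = cinner x y + cinner x z"
  by (metis cinner_add_left cinner_commute complex_cnj_add)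

lemma cinner_scaleC_right: "cinner x (a *\<^sub>C y) = cnj a * cinner x y"
  by (metis cinner_scaleC_left cinner_commute complex_cnj_mult)

lemma cinner_zero_left [simp]: "cinner 0 y = 0"
  using cinner_add_left[of 0 0 y] by simp

lemma cinner_zero_right [simp]: "cinner x 0 = 0"
  using cinner_add_right[of x 0 0] by simp

lemma cinner_minus_left [simp]: "cinner (- x) y = - cinner x y"
  using cinner_add_left[of x "- x" y] by (simp add: add_eq_0_iff)

lemma cinner_minus_right [simp]: "cinner x (- y) = - cinner x y"
  using cinner_add_right[of x y "- y"] by (simp add: add_eq_0_iff)

lemma cinner_diff_left: "cinner (x - y) z = cinner x z - cinner y z"
  using cinner_add_left[of x "- y" z] by simp

lemma cinner_diff_right: "cinner x (y - z) = cinner x y - cinner x z"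
  using cinner_add_right[of x y "- z"] by simp

lemmas cinner_simps = cinner_add_left cinner_add_right cinner_diff_left cinner_diff_right
  cinner_scaleC_left cinner_scaleC_right

lemma cinner_self: "cinner x x = complex_of_real ((norm x)\<^sup>2)"
proof -
  have "Im (cinner x x) = 0" using arg_cong[OF cinner_commute[of x x], of Im] by simp
  thus ?thesis by (simp add: complex_eq_iff power2_norm_eq_inner inner_eq_Re_cinner)
qed

lemma cinner_self_eq_0 [simp]: "cinner x x = 0 \<longleftrightarrow> x = 0"
  by (simp add: cinner_self)

text \<open>Recovers the complex product from the real one, so that real results on continuity and
  orthogonality transfer.\<close>

lemma cinner_eq_inner: "cinner x y = Complex (inner x y) (inner x (\<i> *\<^sub>C y))"
  by (simp add: inner_eq_Re_cinner cinner_scaleC_right complex_eq_iff)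

lemma norm_scaleC: "norm (a *\<^sub>C x) = cmod a * norm (x::'a::chilbert_space)"
proof -
  have "complex_of_real ((norm (a *\<^sub>C x))\<^sup>2) = complex_of_real ((cmod a * norm x)\<^sup>2)"
    using cinner_self[of "a *\<^sub>C x"] cinner_self[of x] complex_norm_square[of a]
    by (simp add: cinner_scaleC_left cinner_scaleC_right power_mult_distrib ac_simps)
  hence "(norm (a *\<^sub>C x))\<^sup>2 = (cmod a * norm x)\<^sup>2" by (simp only: of_real_eq_iff)
  thus ?thesis by simp
qed

lemma bounded_linear_scaleC: "bounded_linear (\<lambda>x::'a::chilbert_space. a *\<^sub>C x)"
  by (rule bounded_linear_intro[where K = "cmod a"])
    (simp_all add: scaleC_add_right scaleR_scaleC scaleC_scaleC norm_scaleC mult.commute)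

lemma cmod_cinner_le: "cmod (cinner x y) \<le> norm x * norm y"
proof (cases "cinner x y = 0")
  case False
  define c where "c = cinner x y"
  \<comment> \<open>Multiplying \<open>x\<close> by \<open>cnj c\<close> makes the product real and
    nonnegative, which reduces the claim to the real Cauchy-Schwarz inequality.\<close>
  have "complex_of_real ((cmod c)\<^sup>2) = cinner (cnj c *\<^sub>C x) y"
    using complex_norm_square[of c] by (simp add: cinner_scaleC_left c_def mult.commute)
  hence "(cmod c)\<^sup>2 = inner (cnj c *\<^sub>C x) y"
    by (metis Re_complex_of_real inner_eq_Re_cinner)
  also have "\<dots> \<le> cmod c * norm x * norm y"
    using norm_cauchy_schwarz[of "cnj c *\<^sub>C x" y] by (simp add: norm_scaleC)
  finally show ?thesis using False by (simp add: c_def power2_eq_square mult.assoc)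
qed simp

lemma continuous_on_cinner_left [continuous_intros]:
  assumes "continuous_on S f"
  shows "continuous_on S (\<lambda>x. cinner (f x) y)"
  unfolding cinner_eq_inner Complex_eq by (intro continuous_intros assms)

section \<open>Complex subspaces, orthogonal projections and Riesz representation\<close>

lemma csubspaceD:
  assumes "csubspace S"
  shows "0 \<in> S" "x \<in> S \<Longrightarrow> y \<in> S \<Longrightarrow> x + y \<in> S" "x \<in> S \<Longrightarrow> a *\<^sub>C x \<in> S"
    "x \<in> S \<Longrightarrow> y \<in> S \<Longrightarrow> x - y \<in> S" "x \<in> S \<Longrightarrow> - x \<in> S"
  by (rule complex_vs.subspace_0[OF assms] complex_vs.subspace_add[OF assms]
      complex_vs.subspace_scale[OF assms] complex_vs.subspace_diff[OF assms]
      complex_vs.subspace_neg[OF assms]; assumption?)+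

lemma csubspace_imp_subspace: "csubspace S \<Longrightarrow> subspace S"
  unfolding subspace_def scaleR_scaleC by (auto intro: csubspaceD)

lemma csubspace_closure:
  assumes "csubspace S"
  shows "csubspace (closure S)"
proof -
  have "x + y \<in> closure S" if xy: "x \<in> closure S" "y \<in> closure S" for x y
  proof -
    obtain f g where "\<And>n. f n \<in> S" "f \<longlonglongrightarrow> x" "\<And>n. g n \<in> S" "g \<longlonglongrightarrow> y"
      using xy unfolding closure_sequential by blast
    hence "(\<lambda>n. f n + g n) \<longlonglongrightarrow> x + y" "\<And>n. f n + g n \<in> S"
      using csubspaceD(2)[OF assms] by (auto intro: tendsto_add)
    thus ?thesis
      unfolding closure_sequential by (intro exI[of _ "\<lambda>n. f n + g n"] conjI allI)
  qed
  moreover have "(\<lambda>x. a *\<^sub>C x) ` closure S \<subseteq> closure S" for a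
    using csubspaceD(3)[OF assms] closure_subset
    by (intro image_closure_subset linear_continuous_on[OF bounded_linear_scaleC]) auto
  hence "a *\<^sub>C x \<in> closure S" if "x \<in> closure S" for a x using that by blast
  moreover have "0 \<in> closure S" using csubspaceD(1)[OF assms] closure_subset by blast
  ultimately show ?thesis by (intro complex_vs.subspaceI) auto
qed

text \<open>A complex subspace contains \<open>\<i> *\<^sub>C s\<close> along with \<open>s\<close>;
  real orthogonality to both kills the real and the imaginary part.\<close>

lemma cinner_projection_exists:
  fixes S :: "'a::chilbert_space set"
  assumes S: "csubspace S" "closed S"
  shows "\<exists>y\<in>S. \<forall>s\<in>S. cinner (x - y) s = 0"
proof -
  obtain y where y: "y \<in> S" "\<And>s. s \<in> S \<Longrightarrow> inner (x - y) s = 0"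
    using closed_subspace_projection_exists[OF csubspace_imp_subspace[OF S(1)] S(2)] by metis
  have "cinner (x - y) s = 0" if "s \<in> S" for s
    using y(2)[OF that] y(2)[OF csubspaceD(3)[OF S(1) that, of \<i>]]
    by (simp add: cinner_eq_inner complex_eq_iff)
  with y(1) show ?thesis by blast
qed

text \<open>The difference of two candidates lies in \<open>S\<close> and is orthogonal to itself,
  so the definite description in \<open>orth_proj\<close> denotes the projection.\<close>

lemma orth_proj_exists:
  fixes S :: "'a::chilbert_space set"
  assumes S: "csubspace S" "closed S"
  shows "orth_proj S x \<in> S" "s \<in> S \<Longrightarrow> cinner (x - orth_proj S x) s = 0"
proof -
  obtain y where y: "y \<in> S" "\<And>s. s \<in> S \<Longrightarrow> cinner (x - y) s = 0"
    using cinner_projection_exists[OF S] by metis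
  have "\<exists>!y. y \<in> S \<and> (\<forall>s\<in>S. cinner (x - y) s = 0)"
  proof (rule ex1I[of _ y])
    fix w assume w: "w \<in> S \<and> (\<forall>s\<in>S. cinner (x - w) s = 0)"
    have wy: "w - y \<in> S" using w y(1) csubspaceD[OF S(1)] by blast
    have "cinner (w - y) (w - y) = cinner (x - y) (w - y) - cinner (x - w) (w - y)"
      by (simp add: cinner_diff_left)
    also have "\<dots> = 0" using w y(2) wy by simp
    finally show "w = y" by simp
  qed (use y in blast)
  from theI'[OF this] show "orth_proj S x \<in> S" "s \<in> S \<Longrightarrow> cinner (x - orth_proj S x) s = 0"
    unfolding orth_proj_def by blast+
qed

lemma norm_orth_proj_le:
  fixes S :: "'a::chilbert_space set"
  assumes S: "csubspace S" "closed S"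
  shows "norm (orth_proj S x) \<le> norm x"
proof -
  let ?y = "orth_proj S x"
  have "cinner ?y ?y = cinner x ?y"
    using orth_proj_exists(2)[OF S orth_proj_exists(1)[OF S], of x x] by (simp add: cinner_diff_left)
  hence "(norm ?y)\<^sup>2 \<le> norm x * norm ?y"
    using cmod_cinner_le[of x ?y] cinner_self[of ?y]
    by (metis norm_of_real abs_of_nonneg zero_le_power2)
  thus ?thesis by (cases "?y = 0") (simp_all add: power2_eq_square mult_le_cancel_right)
qed

text \<open>If \<Lambda> is nonzero, its kernel is a closed subspace, and the component
  \<open>w\<close> of \<open>g0\<close> orthogonal to this kernel represents \<Lambda> after
  scaling.\<close>

lemma riesz_antilinear:
  fixes \<Lambda> :: "'a::chilbert_space \<Rightarrow> complex"
  assumes add: "\<And>g k. \<Lambda> (g + k) = \<Lambda> g + \<Lambda> k"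
    and scale: "\<And>c g. \<Lambda> (c *\<^sub>C g) = cnj c * \<Lambda> g"
    and bd: "\<And>g. cmod (\<Lambda> g) \<le> C * norm g"
  obtains x where "\<And>g. cinner x g = \<Lambda> g"
proof (cases "\<forall>g. \<Lambda> g = 0")
  case True
  thus thesis using that[of 0] by simp
next
  case False
  then obtain g0 where g0: "\<Lambda> g0 \<noteq> 0" by blast
  have "bounded_linear \<Lambda>"
    by (rule bounded_linear_intro[where K = C])
      (use add bd in \<open>auto simp: scaleR_scaleC scale mult.commute scaleR_conv_of_real\<close>)
  hence "continuous_on UNIV \<Lambda>" by (rule linear_continuous_on)
  hence cl: "closed {g. \<Lambda> g = 0}" by (intro closed_Collect_eq continuous_intros)
  have zero: "\<Lambda> 0 = 0" using add[of 0 0] by simp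
  have sub: "csubspace {g. \<Lambda> g = 0}"
    by (rule complex_vs.subspaceI) (auto simp: add scale zero)
  obtain y where y: "\<Lambda> y = 0" "\<And>s. \<Lambda> s = 0 \<Longrightarrow> cinner (g0 - y) s = 0"
    using cinner_projection_exists[OF sub cl, of g0] unfolding Ball_def Bex_def mem_Collect_eq
    by (elim exE conjE) simp
  define w where "w = g0 - y"
  have \<Lambda>w: "\<Lambda> w = \<Lambda> g0"
    using add[of "g0 - y" y] y(1) by (simp add: w_def)
  have w0: "w \<noteq> 0" using g0 \<Lambda>w zero by auto
  have "cinner ((\<Lambda> w / cinner w w) *\<^sub>C w) g = \<Lambda> g" for g
  proof -
    \<comment> \<open>The conjugate compensates for antilinearity: subtracting
      \<open>c *\<^sub>C w\<close> from \<open>g\<close> lands in the kernel of \<Lambda>.\<close>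
    define c where "c = cnj (\<Lambda> g / \<Lambda> w)"
    have "\<Lambda> (g + (- c) *\<^sub>C w) = 0" using g0 \<Lambda>w by (simp only: add scale c_def) simp
    hence "cinner w (g + (- c) *\<^sub>C w) = 0" using y(2) by (simp add: w_def)
    hence "cinner w g = \<Lambda> g / \<Lambda> w * cinner w w"
      by (simp add: cinner_diff_right cinner_scaleC_right c_def complex_vs.scale_minus_left)
    thus ?thesis using g0 \<Lambda>w w0 by (simp add: cinner_scaleC_left)
  qed
  thus thesis using that by blast
qed

section \<open>Linear relations and resolvents\<close>

lemma mem_rel_adj: "(u, f) \<in> rel_adj T \<longleftrightarrow> (\<forall>v g. (v, g) \<in> T \<longrightarrow> cinner f v = cinner u g)"
  by (auto simp: rel_adj_def)

lemma rel_adjD: "(u, f) \<in> rel_adj T \<Longrightarrow> (v, g) \<in> T \<Longrightarrow> cinner f v = cinner u g"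
  by (auto simp: rel_adj_def)

lemma csubspace_rel_adj: "csubspace (rel_adj T)"
  by (rule complex_vs.subspaceI)
    (auto simp: mem_rel_adj scaleC_prod_def cinner_simps zero_prod_def)

lemma closed_rel_adj: "closed (rel_adj T)"
proof -
  have "rel_adj T = (\<Inter>y\<in>T. {x. cinner (snd x) (fst y) = cinner (fst x) (snd y)})"
    by (fastforce simp: rel_adj_def)
  thus ?thesis by (auto intro!: closed_INT closed_Collect_eq continuous_intros)
qed

text \<open>If \<open>(a, b)\<close> is the part of \<open>x\<close> orthogonal to \<open>T\<close>,
  then \<open>(b, - a)\<close> lies in the adjoint. Pairing it with \<open>(a, b)\<close>, which
  lies in the double adjoint, gives that the squared norms of \<open>a\<close> and \<open>b\<close>
  add up to 0.\<close>

lemma rel_adj_rel_adj: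
  assumes "csubspace T" "closed T"
  shows "rel_adj (rel_adj T) = T"
proof
  show "T \<subseteq> rel_adj (rel_adj T)"
  proof clarify
    fix a b assume "(a, b) \<in> T"
    thus "(a, b) \<in> rel_adj (rel_adj T)"
      unfolding mem_rel_adj[of a b] using rel_adjD cinner_commute by metis
  qed
  show "rel_adj (rel_adj T) \<subseteq> T"
  proof
    fix x assume x: "x \<in> rel_adj (rel_adj T)"
    obtain y where y: "y \<in> T" "\<And>s. s \<in> T \<Longrightarrow> cinner (x - y) s = 0"
      using cinner_projection_exists[OF assms] by metis
    obtain a b where ab: "x - y = (a, b)" by fastforce
    have "(b, - a) \<in> rel_adj T"
      using y(2) by (auto simp: mem_rel_adj ab cinner_prod_def add_eq_0_iff2)
    moreover have "(a, b) \<in> rel_adj (rel_adj T)"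
      unfolding ab[symmetric]
      using x y(1) \<open>T \<subseteq> rel_adj (rel_adj T)\<close> csubspaceD(4)[OF csubspace_rel_adj] by blast
    ultimately have "cinner b b = - cinner a a" using rel_adjD by fastforce
    hence "cinner (x - y) (x - y) = 0" by (simp add: ab cinner_prod_def)
    thus "x \<in> T" using y(1) by simp
  qed
qed

section \<open>Shifted relations, resolvent operators and conjugation symmetry of the resolvent
  set\<close>

lemma mem_rel_shift: "(f, g) \<in> rel_shift T z \<longleftrightarrow> (f, g + z *\<^sub>C f) \<in> T"
  by (force simp: rel_shift_def)

lemma rel_shiftI: "(f, g) \<in> T \<Longrightarrow> (f, g - z *\<^sub>C f) \<in> rel_shift T z"
  by (auto simp: rel_shift_def)

lemma csubspace_rel_shift:
  assumes "csubspace T"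
  shows "csubspace (rel_shift T z)"
proof (rule complex_vs.subspaceI)
  show "0 \<in> rel_shift T z"
    using csubspaceD(1)[OF assms] by (simp add: zero_prod_def mem_rel_shift)
next
  fix x y assume "x \<in> rel_shift T z" "y \<in> rel_shift T z"
  thus "x + y \<in> rel_shift T z"
    using csubspaceD(2)[OF assms, of "(fst x, snd x + z *\<^sub>C fst x)" "(fst y, snd y + z *\<^sub>C fst y)"]
    by (cases x; cases y) (simp add: mem_rel_shift scaleC_add_right ac_simps)
next
  fix c x assume "x \<in> rel_shift T z"
  thus "c *\<^sub>C x \<in> rel_shift T z"
    using csubspaceD(3)[OF assms, of "(fst x, snd x + z *\<^sub>C fst x)" c]
    by (cases x) (simp add: mem_rel_shift scaleC_prod_def scaleC_add_right scaleC_scaleC ac_simps)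
qed

text \<open>Full range gives existence and trivial kernel gives uniqueness; this justifies the
  definite description in \<open>resolvent\<close>.\<close>

lemma resolvent_set_unique:
  assumes "csubspace T" "z \<in> resolvent_set T"
  shows "\<exists>!f. (f, g) \<in> rel_shift T z"
proof -
  have "\<exists>f. (f, g) \<in> rel_shift T z" using assms(2) by (auto simp: resolvent_set_def)
  moreover have "f = k" if "(f, g) \<in> rel_shift T z" "(k, g) \<in> rel_shift T z" for f k
  proof -
    have "(f - k, 0) \<in> rel_shift T z"
      using csubspaceD(4)[OF csubspace_rel_shift[OF assms(1)] that] by simp
    hence "f - k \<in> {0}" using assms(2) unfolding resolvent_set_def rel_ker_def by blast
    thus ?thesis by simp
  qed
  ultimately show ?thesis by blast
qed

lemma resolvent_mem:
  assumes "csubspace T" "z \<in> resolvent_set T"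
  shows "(resolvent T z g, g) \<in> rel_shift T z"
  unfolding resolvent_def using theI'[OF resolvent_set_unique[OF assms]] by simp

lemma resolvent_eqI:
  assumes "csubspace T" "z \<in> resolvent_set T" "(f, g) \<in> rel_shift T z"
  shows "resolvent T z g = f"
  using resolvent_mem[OF assms(1,2)] resolvent_set_unique[OF assms(1,2)] assms(3) by blast

lemma resolvent_add:
  assumes "csubspace T" "z \<in> resolvent_set T"
  shows "resolvent T z (g + k) = resolvent T z g + resolvent T z k"
  using csubspaceD(2)[OF csubspace_rel_shift[OF assms(1)] resolvent_mem[OF assms] resolvent_mem[OF assms]]
  by (intro resolvent_eqI[OF assms]) simp

lemma resolvent_scaleC:
  assumes "csubspace T" "z \<in> resolvent_set T"
  shows "resolvent T z (c *\<^sub>C g) = c *\<^sub>C resolvent T z g"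
  using csubspaceD(3)[OF csubspace_rel_shift[OF assms(1)] resolvent_mem[OF assms]]
  by (intro resolvent_eqI[OF assms]) (simp add: scaleC_prod_def)

text \<open>Testing a solution \<open>k\<close> of \<open>k' - cnj z k = g\<close> with \<open>norm g \<le> 1\<close> against
  \<open>f' - z f\<close> gives \<open>cinner g f\<close>; as \<open>T - z\<close> is onto, these \<open>k\<close> form a weakly bounded set.\<close>

lemma selfadjoint_shift_cnj_bounded_below:
  fixes T :: "'h::chilbert_space linrel"
  assumes T: "rel_adj T = T" and z: "z \<in> resolvent_set T"
  obtains C where "C \<ge> 0" "\<And>k g. (k, g) \<in> rel_shift T (cnj z) \<Longrightarrow> norm k \<le> C * norm g"
proof -
  have sub: "csubspace T" using csubspace_rel_adj[of T] T by simp
  note sub' = csubspace_rel_shift[OF sub, of "cnj z"]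
  have test: "cinner k y = cinner g (resolvent T z y)" if "(k, g) \<in> rel_shift T (cnj z)" for k g y
  proof -
    have "(resolvent T z y, y + z *\<^sub>C resolvent T z y) \<in> T" "(k, g + cnj z *\<^sub>C k) \<in> rel_adj T"
      using resolvent_mem[OF sub z, of y] that by (simp_all add: mem_rel_shift T)
    from rel_adjD[OF this(2,1)] show ?thesis by (simp add: cinner_simps)
  qed
  define S where "S = {k. \<exists>g. (k, g) \<in> rel_shift T (cnj z) \<and> norm g \<le> 1}"
  have "\<exists>M. \<forall>k\<in>S. \<bar>inner k y\<bar> \<le> M" for y
  proof (intro exI ballI)
    fix k assume "k \<in> S"
    then obtain g where g: "(k, g) \<in> rel_shift T (cnj z)" "norm g \<le> 1" by (auto simp: S_def)
    have "\<bar>inner k y\<bar> \<le> cmod (cinner k y)" by (simp add: inner_eq_Re_cinner abs_Re_le_cmod)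
    also have "\<dots> \<le> norm g * norm (resolvent T z y)" using test[OF g(1)] cmod_cinner_le by simp
    also have "\<dots> \<le> norm (resolvent T z y)" using g(2) by (simp add: mult_left_le_one_le)
    finally show "\<bar>inner k y\<bar> \<le> norm (resolvent T z y)" .
  qed
  from weakly_bounded_imp_bounded[OF this] obtain B where B: "B > 0" "\<And>k. k \<in> S \<Longrightarrow> norm k \<le> B"
    using bounded_pos by blast
  \<comment> \<open>Homogeneity extends the bound from \<open>norm g \<le> 1\<close>. For
    \<open>g = 0\<close> no normalisation is possible, but testing against \<open>k\<close> itself
    yields \<open>k = 0\<close>.\<close>
  have "norm k \<le> B * norm g" if kg: "(k, g) \<in> rel_shift T (cnj z)" for k g
  proof (cases "g = 0")
    case True
    thus ?thesis using test[OF kg, of k] by simp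
  next
    case False
    define t where "t = complex_of_real (1 / norm g)"
    have "(t *\<^sub>C k, t *\<^sub>C g) \<in> rel_shift T (cnj z)"
      using csubspaceD(3)[OF sub' kg, of t] by (simp add: scaleC_prod_def)
    moreover have "norm (t *\<^sub>C g) \<le> 1" using False by (simp add: norm_scaleC t_def norm_divide)
    ultimately have "norm (t *\<^sub>C k) \<le> B" using B(2) by (auto simp: S_def)
    thus ?thesis using False by (simp add: norm_scaleC t_def norm_divide field_simps)
  qed
  thus thesis using B(1) that[of B] by simp
qed

text \<open>Boundedness below gives \<open>T - cnj z\<close> a trivial kernel and a closed range.
  The orthogonal complement of the range is the kernel of \<open>T - z\<close>, which is trivial, so
  the range is everything.\<close>

lemma selfadjoint_resolvent_set_cnj:
  fixes T :: "'h::chilbert_space linrel"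
  assumes T: "rel_adj T = T" and z: "z \<in> resolvent_set T"
  shows "cnj z \<in> resolvent_set T"
proof -
  define w where "w = cnj z"
  have sub: "csubspace T" using csubspace_rel_adj[of T] T by simp
  note sub' = csubspace_rel_shift[OF sub, of w]
  obtain C where C: "C \<ge> 0" "\<And>k g. (k, g) \<in> rel_shift T w \<Longrightarrow> norm k \<le> C * norm g"
    using selfadjoint_shift_cnj_bounded_below[OF T z] unfolding w_def by metis
  have "k = 0" if "(k, 0) \<in> rel_shift T w" for k
    using C(2)[OF that] by simp
  hence ker: "rel_ker (rel_shift T w) = {0}"
    using csubspaceD(1)[OF sub'] by (auto simp: rel_ker_def zero_prod_def)
  let ?R = "Range (rel_shift T w)"
  have R: "csubspace ?R"
  proof (rule complex_vs.subspaceI)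
    show "0 \<in> ?R" using csubspaceD(1)[OF sub'] by (auto simp: zero_prod_def)
  next
    fix x y assume "x \<in> ?R" "y \<in> ?R"
    then obtain a b where "(a, x) \<in> rel_shift T w" "(b, y) \<in> rel_shift T w" by blast
    from csubspaceD(2)[OF sub' this] show "x + y \<in> ?R" by auto
  next
    fix c x assume "x \<in> ?R"
    then obtain a where "(a, x) \<in> rel_shift T w" by blast
    from csubspaceD(3)[OF sub' this, of c] show "c *\<^sub>C x \<in> ?R" by (auto simp: scaleC_prod_def)
  qed
  have "l \<in> ?R" if y: "\<And>n. y n \<in> ?R" "y \<longlonglongrightarrow> l" for y l
  proof -
    obtain k where k: "\<And>n. (k n, y n) \<in> rel_shift T w" using y(1) unfolding Range_iff by metis
    have kd: "norm (k m - k n) \<le> C * norm (y m - y n)" for m n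
      using C(2)[of "k m - k n" "y m - y n"] csubspaceD(4)[OF sub' k k, of m n] by simp
    have "Cauchy k"
    proof (rule CauchyI)
      fix e :: real assume e: "e > 0"
      have "Cauchy y" using y(2) LIMSEQ_imp_Cauchy by blast
      \<comment> \<open>Dividing by \<open>C + 1\<close> rather than \<open>C\<close> covers the
        case \<open>C = 0\<close>.\<close>
      then obtain M where M: "\<And>m n. m \<ge> M \<Longrightarrow> n \<ge> M \<Longrightarrow> norm (y m - y n) < e / (C + 1)"
        using C(1) e CauchyD[of y "e / (C + 1)"] by (auto simp: divide_pos_pos)
      have "norm (k m - k n) < e" if "m \<ge> M" "n \<ge> M" for m n
      proof -
        have "norm (k m - k n) \<le> (C + 1) * norm (y m - y n)"
          using kd[of m n] norm_ge_zero[of "y m - y n"] by (simp only: distrib_right)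
        also have "\<dots> < e" using M[OF that] C(1) by (simp add: field_simps)
        finally show ?thesis .
      qed
      thus "\<exists>M. \<forall>m\<ge>M. \<forall>n\<ge>M. norm (k m - k n) < e" by blast
    qed
    then obtain k0 where k0: "k \<longlonglongrightarrow> k0" using Cauchy_convergent convergent_def by blast
    have "(\<lambda>n. (k n, y n + w *\<^sub>C k n)) \<longlonglongrightarrow> (k0, l + w *\<^sub>C k0)"
      by (intro tendsto_Pair tendsto_add k0 y(2) bounded_linear.tendsto[OF bounded_linear_scaleC])
    moreover have "(k n, y n + w *\<^sub>C k n) \<in> T" for n using k[of n] by (simp add: mem_rel_shift)
    moreover have "closed T" using closed_rel_adj[of T] T by simp
    ultimately have "(k0, l + w *\<^sub>C k0) \<in> T"
      by (meson closed_sequentially)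
    thus ?thesis unfolding mem_rel_shift[symmetric] by blast
  qed
  hence "closed ?R" unfolding closed_sequential_limits by blast
  have "x \<in> ?R" for x
  proof -
    obtain y where y: "y \<in> ?R" "\<And>s. s \<in> ?R \<Longrightarrow> cinner (x - y) s = 0"
      using cinner_projection_exists[OF R \<open>closed ?R\<close>] by metis
    \<comment> \<open>Orthogonality to the range of \<open>T - w\<close> puts \<open>x - y\<close>
      in the kernel of the adjoint shifted by \<open>z\<close>, the conjugate of
      \<open>w\<close>.\<close>
    have "(x - y, z *\<^sub>C (x - y)) \<in> rel_adj T"
      unfolding mem_rel_adj
    proof (intro allI impI)
      fix v g assume "(v, g) \<in> T"
      hence "cinner (x - y) (g - w *\<^sub>C v) = 0" using y(2) rel_shiftI by (metis RangeI)
      thus "cinner (z *\<^sub>C (x - y)) v = cinner (x - y) g"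
        by (simp add: cinner_diff_right cinner_scaleC_right cinner_scaleC_left w_def)
    qed
    hence "x - y \<in> rel_ker (rel_shift T z)" by (simp add: T rel_ker_def mem_rel_shift)
    hence "x - y = 0" using z by (simp add: resolvent_set_def)
    thus ?thesis using y(1) by simp
  qed
  thus ?thesis using ker by (auto simp: resolvent_set_def w_def)
qed

section \<open>The rigging\<close>

text \<open>The difference \<open>h' - k'\<close> is in the multivalued part of the adjoint, which
  is orthogonal to the domain of \<open>A\<close> and by continuity to its closure. Hence the
  projection of \<open>h'\<close> depends on \<open>h\<close> only.\<close>

lemma rel_adj_minus_ker:
  assumes "(h, h') \<in> rel_adj A" "(h, k') \<in> rel_adj A" "s \<in> closure (Domain A)"
  shows "cinner (h' - k') s = 0"
proof -
  have "closed {s. cinner s (h' - k') = 0}"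
    by (intro closed_Collect_eq continuous_intros)
  moreover have "Domain A \<subseteq> {s. cinner s (h' - k') = 0}"
  proof clarify
    fix v g assume "(v, g) \<in> A"
    hence "cinner (h' - k') v = 0" using assms(1,2) by (simp add: cinner_diff_left rel_adjD)
    thus "cinner v (h' - k') = 0" using cinner_commute[of v "h' - k'"] by simp
  qed
  ultimately have "cinner s (h' - k') = 0" using assms(3) closure_minimal by blast
  thus ?thesis using cinner_commute[of "h' - k'" s] by simp
qed

text \<open>The domain of the adjoint is orthogonal to the multivalued part of \<open>A\<close>, so
  the vector \<open>h - l = m - k\<close> is orthogonal to itself.\<close>

lemma rig_plus_decomposition_unique:
  assumes "csubspace A" "(h, h') \<in> rel_adj A" "k \<in> rel_mul A" "(l, l') \<in> rel_adj A" "m \<in> rel_mul A"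
    and eq: "h + k = l + m"
  shows "h = l" "k = m"
proof -
  have "(h - l, h' - l') \<in> rel_adj A" "(0, m - k) \<in> A"
    using csubspaceD(4)[OF csubspace_rel_adj assms(2,4)] csubspaceD(4)[OF assms(1), of "(0, m)" "(0, k)"]
      assms(3,5) by (simp_all add: rel_mul_def)
  from rel_adjD[OF this] have "cinner (h - l) (m - k) = 0" by simp
  moreover have "m - k = h - l" using eq by (simp add: algebra_simps)
  ultimately show "h = l" by simp
  thus "k = m" using eq by simp
qed

lemma rig_plus_norm_eq:
  assumes "csubspace A" "(h, h') \<in> rel_adj A" "k \<in> rel_mul A"
  shows "rig_plus_norm A (h + k) =
    sqrt ((norm h)\<^sup>2 + (norm (orth_proj (closure (Domain A)) h'))\<^sup>2 + (norm k)\<^sup>2)"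
  unfolding rig_plus_norm_def
proof (rule the_equality, goal_cases)
  case 1
  thus ?case using assms by blast
next
  case (2 r)
  then obtain l l' m where l: "(l, l') \<in> rel_adj A" "m \<in> rel_mul A" "h + k = l + m"
    and r: "r = sqrt ((norm l)\<^sup>2 + (norm (orth_proj (closure (Domain A)) l'))\<^sup>2 + (norm m)\<^sup>2)"
    by blast
  have lm: "l = h" "m = k" using rig_plus_decomposition_unique[OF assms l] by auto
  \<comment> \<open>The second components \<open>l'\<close> and \<open>h'\<close> may differ, but
    they impose the same conditions on \<open>y\<close>, so the two descriptions of the projection
    coincide.\<close>
  have "cinner (l' - y) s = cinner (h' - y) s" if "s \<in> closure (Domain A)" for s y
    using rel_adj_minus_ker[OF l(1)[unfolded lm] assms(2) that] by (simp add: cinner_diff_left)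
  hence "orth_proj (closure (Domain A)) l' = orth_proj (closure (Domain A)) h'"
    unfolding orth_proj_def by (metis (no_types, lifting))
  thus ?case by (simp add: r lm)
qed

section \<open>Linear structure of \<open>rig_plus\<close> and estimates for its norm\<close>

lemma csubspace_Domain:
  assumes "csubspace T"
  shows "csubspace (Domain T)"
proof (rule complex_vs.subspaceI)
  show "0 \<in> Domain T" using csubspaceD(1)[OF assms] by (auto simp: zero_prod_def)
next
  fix x y assume "x \<in> Domain T" "y \<in> Domain T"
  then obtain a b where "(x, a) \<in> T" "(y, b) \<in> T" by blast
  from csubspaceD(2)[OF assms this] show "x + y \<in> Domain T" by auto
next
  fix c x assume "x \<in> Domain T"
  then obtain a where "(x, a) \<in> T" by blast
  from csubspaceD(3)[OF assms this, of c] show "c *\<^sub>C x \<in> Domain T" by (auto simp: scaleC_prod_def)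
qed

lemma csubspace_rel_mul:
  assumes "csubspace T"
  shows "csubspace (rel_mul T)"
proof (rule complex_vs.subspaceI)
  show "0 \<in> rel_mul T" using csubspaceD(1)[OF assms] by (auto simp: zero_prod_def rel_mul_def)
next
  fix x y assume "x \<in> rel_mul T" "y \<in> rel_mul T"
  thus "x + y \<in> rel_mul T" using csubspaceD(2)[OF assms, of "(0, x)" "(0, y)"] by (simp add: rel_mul_def)
next
  fix c x assume "x \<in> rel_mul T"
  thus "c *\<^sub>C x \<in> rel_mul T"
    using csubspaceD(3)[OF assms, of "(0, x)" c] by (simp add: rel_mul_def scaleC_prod_def)
qed

lemma csubspace_rig_plus:
  assumes "csubspace A"
  shows "csubspace (rig_plus A)"
proof -
  have "rig_plus A = {x + y | x y. x \<in> Domain (rel_adj A) \<and> y \<in> rel_mul A}"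
    by (auto simp: rig_plus_def)
  thus ?thesis
    using complex_vs.subspace_sums[OF csubspace_Domain[OF csubspace_rel_adj] csubspace_rel_mul[OF assms]]
    by simp
qed

lemma rig_plusE:
  assumes "x \<in> rig_plus A"
  obtains h h' k where "(h, h') \<in> rel_adj A" "k \<in> rel_mul A" "x = h + k"
  using assms by (auto simp: rig_plus_def)

lemma Domain_rel_adj_rig_plus:
  assumes "csubspace A" "(h, h') \<in> rel_adj A"
  shows "h \<in> rig_plus A"
  unfolding rig_plus_def using assms(2) csubspaceD(1)[OF csubspace_rel_mul[OF assms(1)]]
  by (intro CollectI exI[of _ h] exI[of _ 0]) auto

text \<open>Each summand of the decomposition is bounded by the plus-norm. This continuity of the
  inclusion makes vectors of the Hilbert space bounded functionals on
  \<open>rig_plus\<close>.\<close>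

lemma norm_le_rig_plus_norm:
  assumes "csubspace A" "x \<in> rig_plus A"
  shows "norm x \<le> 2 * rig_plus_norm A x"
proof -
  obtain h h' k where x: "(h, h') \<in> rel_adj A" "k \<in> rel_mul A" "x = h + k"
    using assms(2) by (rule rig_plusE)
  have "norm h \<le> rig_plus_norm A x" "norm k \<le> rig_plus_norm A x"
    unfolding x(3) rig_plus_norm_eq[OF assms(1) x(1,2)] by (auto intro: real_le_rsqrt)
  thus ?thesis using norm_triangle_ineq[of h k] by (simp add: x(3))
qed

text \<open>The summand from \<open>rel_mul A\<close> is 0 and the projection shortens
  \<open>h'\<close>. The estimate controls functionals at fixed elements of the adjoint and at
  resolvent values.\<close>

lemma rig_plus_norm_le:
  assumes "csubspace A" "(h, h') \<in> rel_adj A"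
  shows "rig_plus_norm A h \<le> norm h + norm h'"
proof -
  let ?P = "orth_proj (closure (Domain A)) h'"
  have "rig_plus_norm A h = sqrt ((norm h)\<^sup>2 + (norm ?P)\<^sup>2)"
    using rig_plus_norm_eq[OF assms csubspaceD(1)[OF csubspace_rel_mul[OF assms(1)]]] by simp
  also have "\<dots> \<le> norm h + norm ?P" by (rule sqrt_sum_squares_le_sum) simp_all
  also have "norm ?P \<le> norm h'"
    by (intro norm_orth_proj_le csubspace_closure csubspace_Domain assms) simp
  finally show ?thesis by simp
qed

section \<open>Functionals in \<open>rig_minus\<close>\<close>

lemma rig_minusD:
  assumes "\<phi> \<in> rig_minus A"
  shows "h \<in> rig_plus A \<Longrightarrow> k \<in> rig_plus A \<Longrightarrow> \<phi> (h + k) = \<phi> h + \<phi> k"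
    "h \<in> rig_plus A \<Longrightarrow> \<phi> (c *\<^sub>C h) = cnj c * \<phi> h"
    "h \<notin> rig_plus A \<Longrightarrow> \<phi> h = 0"
  using assms unfolding rig_minus_def by auto

lemma rig_minus_bound:
  assumes "csubspace A" "\<phi> \<in> rig_minus A"
  obtains C where "C \<ge> 0" "\<And>h. h \<in> rig_plus A \<Longrightarrow> cmod (\<phi> h) \<le> C * rig_plus_norm A h"
proof -
  obtain C where C: "\<forall>h\<in>rig_plus A. cmod (\<phi> h) \<le> C * rig_plus_norm A h"
    using assms(2) by (auto simp: rig_minus_def)
  have "cmod (\<phi> h) \<le> \<bar>C\<bar> * rig_plus_norm A h" if "h \<in> rig_plus A" for h
  proof -
    have "0 \<le> rig_plus_norm A h"
      using norm_le_rig_plus_norm[OF assms(1) that] norm_ge_zero[of h] by linarith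
    hence "C * rig_plus_norm A h \<le> \<bar>C\<bar> * rig_plus_norm A h" by (intro mult_right_mono) auto
    thus ?thesis using C that by fastforce
  qed
  thus thesis using that[of "\<bar>C\<bar>"] by simp
qed

text \<open>Scaling by \<open>t\<close> moves \<open>h\<close> into the unit ball over which the
  supremum is taken; the summand 1 keeps the denominator positive when \<open>h\<close> and
  \<open>h'\<close> vanish.\<close>

lemma cmod_le_rig_minus_norm:
  assumes "csubspace A" "\<phi> \<in> rig_minus A" "(h, h') \<in> rel_adj A"
  shows "cmod (\<phi> h) \<le> (1 + norm h + norm h') * rig_minus_norm A \<phi>"
proof -
  define t where "t = 1 / (1 + norm h + norm h')"
  have pos: "1 + norm h + norm h' > 0" by (simp add: add_pos_nonneg)
  have t: "t > 0" using pos by (simp add: t_def)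
  let ?k = "complex_of_real t *\<^sub>C h"
  have k: "(?k, complex_of_real t *\<^sub>C h') \<in> rel_adj A"
    using csubspaceD(3)[OF csubspace_rel_adj assms(3)] by (simp add: scaleC_prod_def)
  have "rig_plus_norm A ?k \<le> t * (norm h + norm h')"
    using rig_plus_norm_le[OF assms(1) k] t by (simp add: norm_scaleC distrib_left)
  also have "\<dots> \<le> 1" using pos by (simp add: t_def)
  finally have k1: "?k \<in> {h \<in> rig_plus A. rig_plus_norm A h \<le> 1}"
    using Domain_rel_adj_rig_plus[OF assms(1) k] by simp
  obtain C where C: "C \<ge> 0" "\<And>h. h \<in> rig_plus A \<Longrightarrow> cmod (\<phi> h) \<le> C * rig_plus_norm A h"
    using rig_minus_bound[OF assms(1,2)] by metis
  \<comment> \<open>A real supremum dominates its members only for sets bounded above, which is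
    checked here.\<close>
  have "cmod (\<phi> y) \<le> C" if "y \<in> rig_plus A" "rig_plus_norm A y \<le> 1" for y
    using C(2)[OF that(1)] mult_left_le[OF that(2) C(1)] by linarith
  hence "bdd_above ((\<lambda>h. cmod (\<phi> h)) ` {h \<in> rig_plus A. rig_plus_norm A h \<le> 1})"
    by (intro bdd_aboveI[of _ C]) auto
  from cSUP_upper[OF k1 this] have "cmod (\<phi> ?k) \<le> rig_minus_norm A \<phi>"
    by (simp add: rig_minus_norm_def)
  moreover have "cmod (\<phi> ?k) = t * cmod (\<phi> h)"
    using rig_minusD(2)[OF assms(2) Domain_rel_adj_rig_plus[OF assms(1,3)]] t by (simp add: norm_mult)
  ultimately have "cmod (\<phi> h) \<le> rig_minus_norm A \<phi> / t"
    using t by (simp add: pos_le_divide_eq mult.commute)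
  thus ?thesis by (simp add: t_def mult.commute)
qed

lemma rig_minus_add:
  assumes "csubspace A" "\<phi> \<in> rig_minus A" "\<psi> \<in> rig_minus A"
  shows "\<phi> + \<psi> \<in> rig_minus A"
proof -
  obtain C D where "\<And>h. h \<in> rig_plus A \<Longrightarrow> cmod (\<phi> h) \<le> C * rig_plus_norm A h"
    "\<And>h. h \<in> rig_plus A \<Longrightarrow> cmod (\<psi> h) \<le> D * rig_plus_norm A h"
    using rig_minus_bound[OF assms(1,2)] rig_minus_bound[OF assms(1,3)] by metis
  hence "cmod (\<phi> h + \<psi> h) \<le> (C + D) * rig_plus_norm A h" if "h \<in> rig_plus A" for h
    using that by (smt (verit, best) distrib_right norm_triangle_ineq)
  thus ?thesis
    using rig_minusD[OF assms(2)] rig_minusD[OF assms(3)]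
    by (auto simp: rig_minus_def distrib_left)
qed

lemma rig_embed_in_rig_minus:
  assumes "csubspace A"
  shows "rig_embed A f \<in> rig_minus A"
proof -
  note sub = csubspaceD[OF csubspace_rig_plus[OF assms]]
  have "cmod (cinner f h) \<le> (2 * norm f) * rig_plus_norm A h" if "h \<in> rig_plus A" for h
    using cmod_cinner_le[of f h] mult_left_mono[OF norm_le_rig_plus_norm[OF assms that], of "norm f"]
    by simp
  hence "\<exists>C. \<forall>h\<in>rig_plus A. cmod (cinner f h) \<le> C * rig_plus_norm A h" by blast
  thus ?thesis
    using sub by (simp add: rig_minus_def rig_embed_def cinner_simps)
qed

section \<open>Extension of the boundary maps\<close>

text \<open>Expansion in unit vectors: antilinearity conjugates the coordinates of \<open>w\<close>,
  which matches the conjugated second factor of the product. Truncations \<open>trunc k\<close> add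
  one coordinate at a time.\<close>

lemma antilinear_on_carrier_vec:
  fixes L :: "complex Matrix.vec \<Rightarrow> complex"
  assumes add: "\<And>v w. v \<in> carrier_vec n \<Longrightarrow> w \<in> carrier_vec n \<Longrightarrow> L (v + w) = L v + L w"
    and scale: "\<And>c v. v \<in> carrier_vec n \<Longrightarrow> L (c \<cdot>\<^sub>v v) = cnj c * L v"
    and w: "w \<in> carrier_vec n"
  shows "L w = Matrix.vec n (\<lambda>i. L (unit_vec n i)) \<bullet>c w"
proof -
  define trunc where "trunc k = Matrix.vec n (\<lambda>i. if i < k then vec_index w i else 0)" for k
  have "L (trunc k) = (\<Sum>i<k. cnj (vec_index w i) * L (unit_vec n i))" if "k \<le> n" for k
    using that
  proof (induction k)
    case 0
    \<comment> \<open>Writing the zero vector as a multiple of \<open>w\<close> lets homogeneity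
      give the value 0.\<close>
    have "trunc 0 = 0 \<cdot>\<^sub>v w" using w by (intro eq_vecI) (auto simp: trunc_def)
    thus ?case using scale[OF w, of 0] by simp
  next
    case (Suc k)
    have "trunc (Suc k) = trunc k + vec_index w k \<cdot>\<^sub>v unit_vec n k"
      using Suc.prems by (intro eq_vecI) (auto simp: trunc_def less_Suc_eq)
    thus ?case using Suc add[of "trunc k" "vec_index w k \<cdot>\<^sub>v unit_vec n k"]
        scale[of "unit_vec n k" "vec_index w k"]
      by (simp add: trunc_def)
  qed
  moreover have "trunc n = w" using w by (intro eq_vecI) (auto simp: trunc_def)
  ultimately have "L w = (\<Sum>i<n. cnj (vec_index w i) * L (unit_vec n i))" by (metis order_refl)
  thus ?thesis using w
    by (simp add: scalar_prod_def atLeast0LessThan mult.commute)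
qed

lemma cscalar_prod_eqI:
  fixes u v :: "complex Matrix.vec"
  assumes "u \<in> carrier_vec n" "v \<in> carrier_vec n"
    and "\<And>w. w \<in> carrier_vec n \<Longrightarrow> u \<bullet>c w = v \<bullet>c w"
  shows "u = v"
proof (intro eq_vecI)
  fix i assume "i < dim_vec v"
  hence i: "i < n" using assms(2) by simp
  have "x \<bullet>c unit_vec n i = vec_index x i" if "x \<in> carrier_vec n" for x :: "complex Matrix.vec"
  proof -
    have "conjugate (unit_vec n i) = (unit_vec n i :: complex Matrix.vec)"
      by (intro eq_vecI) (auto simp: unit_vec_def)
    thus ?thesis using i that by simp
  qed
  thus "vec_index u i = vec_index v i" using assms(1,2) assms(3)[of "unit_vec n i"] by simp
qed (use assms in simp)

lemma cvec_norm_le_sum: "cvec_norm v \<le> (\<Sum>i<dim_vec v. cmod (vec_index v i))"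
proof -
  have "v \<bullet>c v = complex_of_real (\<Sum>i<dim_vec v. (cmod (vec_index v i))\<^sup>2)"
    by (simp add: scalar_prod_def atLeast0LessThan complex_norm_square del: of_real_power)
  hence "cvec_norm v = L2_set (\<lambda>i. cmod (vec_index v i)) {..<dim_vec v}"
    by (simp add: cvec_norm_def L2_set_def)
  thus ?thesis using L2_set_le_sum[of "{..<dim_vec v}" "\<lambda>i. cmod (vec_index v i)"] by simp
qed

section \<open>Boundary triples: the common kernel and the selfadjoint extension\<close>

locale symmetric_boundary_triple =
  fixes A :: "'h::chilbert_space linrel" and p :: nat
    and \<Gamma>\<^sub>0 \<Gamma>\<^sub>1 :: "'h \<times> 'h \<Rightarrow> complex Matrix.vec"
  assumes sub: "csubspace A" and clo: "closed A" and sym: "A \<subseteq> rel_adj A"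
    and bt: "boundary_triple A p \<Gamma>\<^sub>0 \<Gamma>\<^sub>1"
begin

abbreviation A\<^sub>0 where "A\<^sub>0 \<equiv> kernel_on (rel_adj A) p \<Gamma>\<^sub>0"

lemma \<Gamma>_linear:
  shows "x \<in> rel_adj A \<Longrightarrow> \<Gamma>\<^sub>0 x \<in> carrier_vec p" "x \<in> rel_adj A \<Longrightarrow> \<Gamma>\<^sub>1 x \<in> carrier_vec p"
    "x \<in> rel_adj A \<Longrightarrow> y \<in> rel_adj A \<Longrightarrow> \<Gamma>\<^sub>0 (x + y) = \<Gamma>\<^sub>0 x + \<Gamma>\<^sub>0 y"
    "x \<in> rel_adj A \<Longrightarrow> y \<in> rel_adj A \<Longrightarrow> \<Gamma>\<^sub>1 (x + y) = \<Gamma>\<^sub>1 x + \<Gamma>\<^sub>1 y"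
    "x \<in> rel_adj A \<Longrightarrow> \<Gamma>\<^sub>0 (c *\<^sub>C x) = c \<cdot>\<^sub>v \<Gamma>\<^sub>0 x" "x \<in> rel_adj A \<Longrightarrow> \<Gamma>\<^sub>1 (c *\<^sub>C x) = c \<cdot>\<^sub>v \<Gamma>\<^sub>1 x"
  using bt unfolding boundary_triple_def linear_map_on_def by blast+

lemma green:
  assumes "x \<in> rel_adj A" "y \<in> rel_adj A"
  shows "cinner (snd x) (fst y) - cinner (fst x) (snd y) = \<Gamma>\<^sub>1 x \<bullet>c \<Gamma>\<^sub>0 y - \<Gamma>\<^sub>0 x \<bullet>c \<Gamma>\<^sub>1 y"
  using bt assms unfolding boundary_triple_def by (cases x; cases y) fastforce

lemma \<Gamma>_surj:
  assumes "\<xi> \<in> carrier_vec p" "\<eta> \<in> carrier_vec p"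
  shows "\<exists>x\<in>rel_adj A. \<Gamma>\<^sub>0 x = \<xi> \<and> \<Gamma>\<^sub>1 x = \<eta>"
proof -
  have "\<xi> @\<^sub>v \<eta> \<in> col_map \<Gamma>\<^sub>0 \<Gamma>\<^sub>1 ` rel_adj A"
    using assms bt unfolding boundary_triple_def mult_2 by (metis append_carrier_vec)
  then obtain x where "x \<in> rel_adj A" "\<xi> @\<^sub>v \<eta> = \<Gamma>\<^sub>0 x @\<^sub>v \<Gamma>\<^sub>1 x" by (auto simp: col_map_def)
  thus ?thesis using append_vec_eq[OF assms(1) \<Gamma>_linear(1)] by metis
qed

lemma \<Gamma>_diff:
  assumes "x \<in> rel_adj A" "y \<in> rel_adj A"
  shows "\<Gamma>\<^sub>0 (x - y) = \<Gamma>\<^sub>0 x - \<Gamma>\<^sub>0 y" "\<Gamma>\<^sub>1 (x - y) = \<Gamma>\<^sub>1 x - \<Gamma>\<^sub>1 y"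
proof -
  have "x - y = x + (- 1) *\<^sub>C y" by (simp add: complex_vs.scale_minus_left)
  moreover have y: "(- 1) *\<^sub>C y \<in> rel_adj A" by (rule csubspaceD(3)[OF csubspace_rel_adj assms(2)])
  ultimately have "\<Gamma>\<^sub>0 (x - y) = \<Gamma>\<^sub>0 x + (- 1) \<cdot>\<^sub>v \<Gamma>\<^sub>0 y" "\<Gamma>\<^sub>1 (x - y) = \<Gamma>\<^sub>1 x + (- 1) \<cdot>\<^sub>v \<Gamma>\<^sub>1 y"
    using \<Gamma>_linear(3)[OF assms(1) y] \<Gamma>_linear(4)[OF assms(1) y] \<Gamma>_linear(5,6)[OF assms(2)]
    by (simp_all only:)
  moreover have "u + (- 1) \<cdot>\<^sub>v v = u - v" if "u \<in> carrier_vec p" "v \<in> carrier_vec p"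
    for u v :: "complex Matrix.vec"
    using that by (intro eq_vecI) auto
  ultimately show "\<Gamma>\<^sub>0 (x - y) = \<Gamma>\<^sub>0 x - \<Gamma>\<^sub>0 y" "\<Gamma>\<^sub>1 (x - y) = \<Gamma>\<^sub>1 x - \<Gamma>\<^sub>1 y"
    using \<Gamma>_linear(1,2) assms by auto
qed

text \<open>For \<open>x\<close> in \<open>A\<close> the left side of Green's identity vanishes
  against every \<open>y\<close>; surjectivity provides \<open>y\<close> that turn the right side
  into the squared norm of either boundary value. Conversely, zero boundary values put
  \<open>x\<close> in the double adjoint, which is \<open>A\<close>.\<close>

lemma mem_A_iff: "x \<in> A \<longleftrightarrow> x \<in> rel_adj A \<and> \<Gamma>\<^sub>0 x = 0\<^sub>v p \<and> \<Gamma>\<^sub>1 x = 0\<^sub>v p"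
proof
  assume x: "x \<in> A"
  hence x': "x \<in> rel_adj A" using sym by blast
  have z: "\<Gamma>\<^sub>1 y \<bullet>c \<Gamma>\<^sub>0 x - \<Gamma>\<^sub>0 y \<bullet>c \<Gamma>\<^sub>1 x = 0" if "y \<in> rel_adj A" for y
    using green[OF that x'] that x rel_adjD[of "fst y" "snd y" A "fst x" "snd x"] by simp
  have "\<Gamma>\<^sub>0 x = 0\<^sub>v p"
  proof -
    obtain y where "y \<in> rel_adj A" "\<Gamma>\<^sub>0 y = 0\<^sub>v p" "\<Gamma>\<^sub>1 y = \<Gamma>\<^sub>0 x"
      using \<Gamma>_surj[of "0\<^sub>v p" "\<Gamma>\<^sub>0 x"] \<Gamma>_linear(1)[OF x'] by auto
    thus ?thesis using z[of y] \<Gamma>_linear(1,2)[OF x'] conjugate_square_eq_0_vec[of "\<Gamma>\<^sub>0 x" p] by simp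
  qed
  moreover have "\<Gamma>\<^sub>1 x = 0\<^sub>v p"
  proof -
    obtain y where "y \<in> rel_adj A" "\<Gamma>\<^sub>1 y = 0\<^sub>v p" "\<Gamma>\<^sub>0 y = \<Gamma>\<^sub>1 x"
      using \<Gamma>_surj[of "\<Gamma>\<^sub>1 x" "0\<^sub>v p"] \<Gamma>_linear(2)[OF x'] by auto
    thus ?thesis using z[of y] \<Gamma>_linear(1,2)[OF x'] conjugate_square_eq_0_vec[of "\<Gamma>\<^sub>1 x" p] by simp
  qed
  ultimately show "x \<in> rel_adj A \<and> \<Gamma>\<^sub>0 x = 0\<^sub>v p \<and> \<Gamma>\<^sub>1 x = 0\<^sub>v p" using x' by simp
next
  assume x: "x \<in> rel_adj A \<and> \<Gamma>\<^sub>0 x = 0\<^sub>v p \<and> \<Gamma>\<^sub>1 x = 0\<^sub>v p"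
  have "(fst x, snd x) \<in> rel_adj (rel_adj A)"
    unfolding mem_rel_adj[of _ _ "rel_adj A"]
  proof (intro allI impI)
    fix v g assume vg: "(v, g) \<in> rel_adj A"
    show "cinner (snd x) v = cinner (fst x) g"
      using green[OF _ vg, of x] x \<Gamma>_linear(1,2)[OF vg] by simp
  qed
  thus "x \<in> A" using rel_adj_rel_adj[OF sub clo] by simp
qed

lemma A_subset_A\<^sub>0: "A \<subseteq> A\<^sub>0"
  using mem_A_iff by (auto simp: kernel_on_def)

text \<open>Green's form vanishes on \<open>A\<^sub>0\<close>. For the other inclusion,
  \<open>y\<close> in \<open>A\<^sub>0\<close> is chosen so that its second boundary value equals
  the first one of \<open>(f, f')\<close>.\<close>

lemma A\<^sub>0_selfadjoint: "rel_adj A\<^sub>0 = A\<^sub>0"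
proof
  show "A\<^sub>0 \<subseteq> rel_adj A\<^sub>0"
  proof clarify
    fix f f' assume f: "(f, f') \<in> A\<^sub>0"
    show "(f, f') \<in> rel_adj A\<^sub>0"
      unfolding mem_rel_adj[of _ _ "A\<^sub>0"]
    proof (intro allI impI)
      fix v g assume v: "(v, g) \<in> A\<^sub>0"
      show "cinner f' v = cinner f g"
        using green[of "(f, f')" "(v, g)"] f v \<Gamma>_linear(2)[of "(f, f')"] \<Gamma>_linear(2)[of "(v, g)"]
        by (simp add: kernel_on_def)
    qed
  qed
  show "rel_adj A\<^sub>0 \<subseteq> A\<^sub>0"
  proof clarify
    fix f f' assume f: "(f, f') \<in> rel_adj A\<^sub>0"
    have f': "(f, f') \<in> rel_adj A" using f A_subset_A\<^sub>0 by (auto simp: rel_adj_def)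
    obtain y where y: "y \<in> rel_adj A" "\<Gamma>\<^sub>0 y = 0\<^sub>v p" "\<Gamma>\<^sub>1 y = \<Gamma>\<^sub>0 (f, f')"
      using \<Gamma>_surj[of "0\<^sub>v p" "\<Gamma>\<^sub>0 (f, f')"] \<Gamma>_linear(1)[OF f'] by auto
    have "y \<in> A\<^sub>0" using y by (simp add: kernel_on_def)
    hence "cinner f' (fst y) = cinner f (snd y)"
      using rel_adjD[OF f, of "fst y" "snd y"] by simp
    hence "\<Gamma>\<^sub>0 (f, f') \<bullet>c \<Gamma>\<^sub>0 (f, f') = 0"
      using green[OF f' y(1)] y(2,3) \<Gamma>_linear(1,2)[OF f'] by simp
    thus "(f, f') \<in> A\<^sub>0" using f' \<Gamma>_linear(1)[OF f'] by (simp add: kernel_on_def)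
  qed
qed

lemma csubspace_A\<^sub>0: "csubspace A\<^sub>0"
  using csubspace_rel_adj[of "A\<^sub>0"] A\<^sub>0_selfadjoint by simp

section \<open>The gamma field and the extended resolvent\<close>

text \<open>\<open>defect_graph A w\<close> complements \<open>A\<^sub>0\<close> in the adjoint:
  trivial kernel of \<open>A\<^sub>0 - w\<close> makes \<open>\<Gamma>\<^sub>0\<close> injective on
  it, full range makes it onto, so the inverse is a genuine one.\<close>

lemma gamma_hat_props:
  assumes w: "w \<in> resolvent_set A\<^sub>0" and \<xi>: "\<xi> \<in> carrier_vec p"
  shows "gamma_hat A \<Gamma>\<^sub>0 w \<xi> = (gamma_field A \<Gamma>\<^sub>0 w \<xi>, w *\<^sub>C gamma_field A \<Gamma>\<^sub>0 w \<xi>)"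
    "gamma_hat A \<Gamma>\<^sub>0 w \<xi> \<in> rel_adj A" "\<Gamma>\<^sub>0 (gamma_hat A \<Gamma>\<^sub>0 w \<xi>) = \<xi>"
proof -
  have mem: "x \<in> defect_graph A w \<longleftrightarrow> x \<in> rel_adj A \<and> snd x = w *\<^sub>C fst x" for x
    by (cases x) (auto simp: defect_graph_def defect_space_def rel_ker_def mem_rel_shift)
  have inj: "inj_on \<Gamma>\<^sub>0 (defect_graph A w)"
  proof (rule inj_onI)
    fix x y assume x: "x \<in> defect_graph A w" and y: "y \<in> defect_graph A w" and eq: "\<Gamma>\<^sub>0 x = \<Gamma>\<^sub>0 y"
    have "x - y \<in> rel_adj A" using x y by (simp add: mem csubspaceD(4)[OF csubspace_rel_adj])
    moreover have "\<Gamma>\<^sub>0 (x - y) = 0\<^sub>v p"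
      using x y eq \<Gamma>_diff(1)[of x y] \<Gamma>_linear(1)[of y] by (simp add: mem)
    moreover have "x - y = (fst x - fst y, w *\<^sub>C (fst x - fst y))"
      using x y by (simp add: mem complex_vs.scale_right_diff_distrib prod_eq_iff)
    ultimately have "fst x - fst y \<in> rel_ker (rel_shift A\<^sub>0 w)"
      by (simp add: rel_ker_def mem_rel_shift kernel_on_def)
    hence "fst x = fst y" using w by (simp add: resolvent_set_def)
    thus "x = y" using x y by (simp add: mem prod_eq_iff)
  qed
  have "\<xi> \<in> \<Gamma>\<^sub>0 ` defect_graph A w"
  proof -
    obtain x where x: "x \<in> rel_adj A" "\<Gamma>\<^sub>0 x = \<xi>" using \<Gamma>_surj[OF \<xi> \<xi>] by blast
    \<comment> \<open>The element \<open>y\<close> of \<open>A\<^sub>0\<close> is built to have the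
      same image as \<open>x\<close> under the shift by \<open>w\<close>; subtracting it leaves
      \<open>\<Gamma>\<^sub>0\<close> unchanged and lands in the defect graph.\<close>
    define f where "f = resolvent A\<^sub>0 w (snd x - w *\<^sub>C fst x)"
    define y where "y = (f, snd x - w *\<^sub>C fst x + w *\<^sub>C f)"
    have y: "y \<in> A\<^sub>0"
      using resolvent_mem[OF csubspace_A\<^sub>0 w, of "snd x - w *\<^sub>C fst x"]
      by (simp add: mem_rel_shift f_def y_def)
    hence y': "y \<in> rel_adj A" "\<Gamma>\<^sub>0 y = 0\<^sub>v p" by (simp_all add: kernel_on_def)
    have "x - y \<in> rel_adj A" "\<Gamma>\<^sub>0 (x - y) = \<xi>"
      using x \<xi> csubspaceD(4)[OF csubspace_rel_adj x(1) y'(1)] \<Gamma>_diff(1)[OF x(1) y'(1)] y'(2)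
      by simp_all
    moreover have "snd (x - y) = w *\<^sub>C fst (x - y)"
      by (simp add: y_def complex_vs.scale_right_diff_distrib)
    ultimately show ?thesis unfolding mem[symmetric] by (metis image_eqI mem)
  qed
  hence "gamma_hat A \<Gamma>\<^sub>0 w \<xi> \<in> defect_graph A w" "\<Gamma>\<^sub>0 (gamma_hat A \<Gamma>\<^sub>0 w \<xi>) = \<xi>"
    unfolding gamma_hat_def
    using the_inv_into_into[OF inj _ order_refl] f_the_inv_into_f[OF inj] by auto
  thus "gamma_hat A \<Gamma>\<^sub>0 w \<xi> = (gamma_field A \<Gamma>\<^sub>0 w \<xi>, w *\<^sub>C gamma_field A \<Gamma>\<^sub>0 w \<xi>)"
    "gamma_hat A \<Gamma>\<^sub>0 w \<xi> \<in> rel_adj A" "\<Gamma>\<^sub>0 (gamma_hat A \<Gamma>\<^sub>0 w \<xi>) = \<xi>"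
    by (simp_all add: mem gamma_field_def prod_eq_iff)
qed

text \<open>Riesz representation applies because the resolvent at \<open>cnj z\<close> is bounded
  into \<open>rig_plus A\<close>, so composing it with \<phi> gives a bounded antilinear
  form.\<close>

lemma ext_resolvent_eq:
  assumes z: "z \<in> resolvent_set A\<^sub>0" and \<phi>: "\<phi> \<in> rig_minus A"
  shows "cinner (ext_resolvent A\<^sub>0 z \<phi>) g = \<phi> (resolvent A\<^sub>0 (cnj z) g)"
proof -
  define w where "w = cnj z"
  define R where "R = resolvent A\<^sub>0 w"
  have w: "w \<in> resolvent_set A\<^sub>0"
    unfolding w_def by (rule selfadjoint_resolvent_set_cnj[OF A\<^sub>0_selfadjoint z])
  have R: "(R g, g + w *\<^sub>C R g) \<in> rel_adj A" "(R g, g) \<in> rel_shift A\<^sub>0 w" for g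
    using resolvent_mem[OF csubspace_A\<^sub>0 w, of g] by (auto simp: mem_rel_shift R_def kernel_on_def)
  note Rp = Domain_rel_adj_rig_plus[OF sub R(1)]
  obtain C where C: "C \<ge> 0" "\<And>k g. (k, g) \<in> rel_shift A\<^sub>0 w \<Longrightarrow> norm k \<le> C * norm g"
    using selfadjoint_shift_cnj_bounded_below[OF A\<^sub>0_selfadjoint z] unfolding w_def by metis
  obtain D where D: "D \<ge> 0" "\<And>h. h \<in> rig_plus A \<Longrightarrow> cmod (\<phi> h) \<le> D * rig_plus_norm A h"
    using rig_minus_bound[OF sub \<phi>] by metis
  have "\<exists>x. \<forall>g. cinner x g = \<phi> (R g)"
  \<comment> \<open>\<open>D\<close> bounds \<phi>, \<open>C\<close> bounds \<open>R g\<close>, and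
    \<open>1 + cmod w * C\<close> bounds \<open>g + w *\<^sub>C R g\<close>, the second component
    over \<open>R g\<close>.\<close>
  proof (rule riesz_antilinear[of "\<lambda>g. \<phi> (R g)" "D * (C + (1 + cmod w * C))"])
    show "\<phi> (R (g + k)) = \<phi> (R g) + \<phi> (R k)" for g k
      using rig_minusD(1)[OF \<phi> Rp Rp] by (simp add: R_def resolvent_add[OF csubspace_A\<^sub>0 w])
    show "\<phi> (R (c *\<^sub>C g)) = cnj c * \<phi> (R g)" for c g
      using rig_minusD(2)[OF \<phi> Rp] by (simp add: R_def resolvent_scaleC[OF csubspace_A\<^sub>0 w])
    show "cmod (\<phi> (R g)) \<le> D * (C + (1 + cmod w * C)) * norm g" for g
    proof -
      have RC: "norm (R g) \<le> C * norm g" by (rule C(2)[OF R(2)])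
      have "norm (g + w *\<^sub>C R g) \<le> norm g + cmod w * norm (R g)"
        using norm_triangle_ineq[of g "w *\<^sub>C R g"] by (simp add: norm_scaleC)
      also have "cmod w * norm (R g) \<le> cmod w * (C * norm g)" by (rule mult_left_mono[OF RC]) simp
      finally have "rig_plus_norm A (R g) \<le> (C + (1 + cmod w * C)) * norm g"
        using rig_plus_norm_le[OF sub R(1), of g] RC by (simp add: algebra_simps)
      from mult_left_mono[OF this D(1)] show ?thesis using D(2)[OF Rp, of g] by (simp add: mult.assoc)
    qed
  qed blast
  then obtain x where x: "\<And>g. cinner x g = \<phi> (R g)" by blast
  have "ext_resolvent A\<^sub>0 z \<phi> = x"
    unfolding ext_resolvent_def
  proof (rule the_equality)
    fix y assume "\<forall>g. cinner y g = \<phi> (resolvent A\<^sub>0 (cnj z) g)"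
    hence "cinner (y - x) (y - x) = 0" using x by (simp add: cinner_diff_left R_def w_def)
    thus "y = x" by simp
  qed (use x in \<open>simp add: R_def w_def\<close>)
  thus ?thesis using x by (simp add: R_def w_def)
qed

section \<open>The defect form and its representation by boundary values\<close>

definition defect_form :: "'h \<times> ('h \<Rightarrow> complex) \<Rightarrow> 'h \<times> 'h \<Rightarrow> complex" where
  "defect_form x y = snd x (fst y) - cinner (fst x) (snd y)"

text \<open>A chosen right inverse of the pair of boundary maps; it is linear only modulo
  \<open>A\<close>.\<close>

definition lift :: "complex Matrix.vec \<Rightarrow> complex Matrix.vec \<Rightarrow> 'h \<times> 'h" where
  "lift \<xi> \<eta> = (SOME x. x \<in> rel_adj A \<and> \<Gamma>\<^sub>0 x = \<xi> \<and> \<Gamma>\<^sub>1 x = \<eta>)"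

text \<open>The minus sign and the slot of the unit vector follow Green's identity, where
  \<open>\<Gamma>\<^sub>0\<close> of the first argument is paired negatively with
  \<open>\<Gamma>\<^sub>1\<close> of the second.\<close>

definition ext_\<Gamma>\<^sub>0 :: "'h \<times> ('h \<Rightarrow> complex) \<Rightarrow> complex Matrix.vec" where
  "ext_\<Gamma>\<^sub>0 x = Matrix.vec p (\<lambda>i. - defect_form x (lift (0\<^sub>v p) (unit_vec p i)))"

definition ext_\<Gamma>\<^sub>1 :: "'h \<times> ('h \<Rightarrow> complex) \<Rightarrow> complex Matrix.vec" where
  "ext_\<Gamma>\<^sub>1 x = Matrix.vec p (\<lambda>i. defect_form x (lift (unit_vec p i) (0\<^sub>v p)))"

lemma ext_\<Gamma>_carrier [simp]: "ext_\<Gamma>\<^sub>0 x \<in> carrier_vec p" "ext_\<Gamma>\<^sub>1 x \<in> carrier_vec p"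
  by (simp_all add: ext_\<Gamma>\<^sub>0_def ext_\<Gamma>\<^sub>1_def)

lemma lift:
  assumes "\<xi> \<in> carrier_vec p" "\<eta> \<in> carrier_vec p"
  shows "lift \<xi> \<eta> \<in> rel_adj A" "\<Gamma>\<^sub>0 (lift \<xi> \<eta>) = \<xi>" "\<Gamma>\<^sub>1 (lift \<xi> \<eta>) = \<eta>"
  using someI_ex[of "\<lambda>x. x \<in> rel_adj A \<and> \<Gamma>\<^sub>0 x = \<xi> \<and> \<Gamma>\<^sub>1 x = \<eta>"] \<Gamma>_surj[OF assms]
  unfolding lift_def by blast+

lemma mem_rig_rel: "x \<in> rig_rel A B \<longleftrightarrow> snd x \<in> rig_minus A \<and> (\<forall>y\<in>B. defect_form x y = 0)"
  by (cases x) (force simp: rig_rel_def defect_form_def)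

lemma fst_rel_adj_rig_plus: "y \<in> rel_adj A \<Longrightarrow> fst y \<in> rig_plus A"
  using Domain_rel_adj_rig_plus[OF sub, of "fst y" "snd y"] by simp

lemma defect_form_antilinear:
  assumes "snd x \<in> rig_minus A" "y \<in> rel_adj A"
  shows "y' \<in> rel_adj A \<Longrightarrow> defect_form x (y + y') = defect_form x y + defect_form x y'"
    "defect_form x (c *\<^sub>C y) = cnj c * defect_form x y"
  using rig_minusD[OF assms(1)] assms(2) fst_rel_adj_rig_plus
  by (simp_all add: defect_form_def scaleC_prod_def cinner_simps algebra_simps)

text \<open>Equal boundary values mean that \<open>y - y'\<close> is in \<open>A\<close>, where the
  form of \<open>x\<close> vanishes; thus the form factors through the boundary maps.\<close>

lemma defect_form_cong:
  assumes x: "x \<in> rig_rel A A" and y: "y \<in> rel_adj A" "y' \<in> rel_adj A"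
    and eq: "\<Gamma>\<^sub>0 y = \<Gamma>\<^sub>0 y'" "\<Gamma>\<^sub>1 y = \<Gamma>\<^sub>1 y'"
  shows "defect_form x y = defect_form x y'"
proof -
  have "y - y' \<in> A"
    unfolding mem_A_iff using csubspaceD(4)[OF csubspace_rel_adj y] \<Gamma>_diff[OF y] eq \<Gamma>_linear(1,2)[OF y(2)]
    by simp
  hence "defect_form x (y - y') = 0" "y - y' \<in> rel_adj A" using x sym by (auto simp: mem_rig_rel)
  thus ?thesis using defect_form_antilinear(1)[of x "y - y'" y'] x y by (simp add: mem_rig_rel)
qed

text \<open>Green's identity with a generalised first argument. On each of the two blocks of
  coordinates the form is antilinear, hence given by its values at unit vectors.\<close>

lemma defect_form_ext_\<Gamma>:
  assumes x: "x \<in> rig_rel A A" and y: "y \<in> rel_adj A"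
  shows "defect_form x y = ext_\<Gamma>\<^sub>1 x \<bullet>c \<Gamma>\<^sub>0 y - ext_\<Gamma>\<^sub>0 x \<bullet>c \<Gamma>\<^sub>1 y"
proof -
  let ?o = "0\<^sub>v p :: complex Matrix.vec"
  have o: "?o \<in> carrier_vec p" by simp
  have co: "c \<cdot>\<^sub>v ?o = ?o" for c by (intro eq_vecI) auto
  have \<phi>: "snd x \<in> rig_minus A" using x by (simp add: mem_rig_rel)
  note anti = defect_form_antilinear[OF \<phi>]
  note add = csubspaceD(2)[OF csubspace_rel_adj] and scale = csubspaceD(3)[OF csubspace_rel_adj]
  have 1: "defect_form x (lift \<xi> ?o) = ext_\<Gamma>\<^sub>1 x \<bullet>c \<xi>" if \<xi>: "\<xi> \<in> carrier_vec p" for \<xi>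
    unfolding ext_\<Gamma>\<^sub>1_def
  proof (rule antilinear_on_carrier_vec[of p "\<lambda>\<xi>. defect_form x (lift \<xi> ?o)", OF _ _ \<xi>])
    fix v w :: "complex Matrix.vec" assume v: "v \<in> carrier_vec p" and w: "w \<in> carrier_vec p"
    \<comment> \<open>The two arguments need not be equal, but they have the same boundary
      values.\<close>
    have "defect_form x (lift (v + w) ?o) = defect_form x (lift v ?o + lift w ?o)"
      using lift[OF v o] lift[OF w o] lift[of "v + w" ?o] v w
      by (intro defect_form_cong[OF x]) (simp_all add: add \<Gamma>_linear)
    thus "defect_form x (lift (v + w) ?o) = defect_form x (lift v ?o) + defect_form x (lift w ?o)"
      using anti(1) lift(1)[OF v o] lift(1)[OF w o] by simp
  next
    fix v :: "complex Matrix.vec" and c assume v: "v \<in> carrier_vec p"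
    have "defect_form x (lift (c \<cdot>\<^sub>v v) ?o) = defect_form x (c *\<^sub>C lift v ?o)"
      using lift[OF v o] lift[of "c \<cdot>\<^sub>v v" ?o] v
      by (intro defect_form_cong[OF x]) (simp_all add: scale \<Gamma>_linear co)
    thus "defect_form x (lift (c \<cdot>\<^sub>v v) ?o) = cnj c * defect_form x (lift v ?o)"
      using anti(2) lift(1)[OF v o] by simp
  qed
  have 0: "- defect_form x (lift ?o \<eta>) = ext_\<Gamma>\<^sub>0 x \<bullet>c \<eta>" if \<eta>: "\<eta> \<in> carrier_vec p" for \<eta>
    unfolding ext_\<Gamma>\<^sub>0_def
  proof (rule antilinear_on_carrier_vec[of p "\<lambda>\<eta>. - defect_form x (lift ?o \<eta>)", OF _ _ \<eta>])
    fix v w :: "complex Matrix.vec" assume v: "v \<in> carrier_vec p" and w: "w \<in> carrier_vec p"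
    have "defect_form x (lift ?o (v + w)) = defect_form x (lift ?o v + lift ?o w)"
      using lift[OF o v] lift[OF o w] lift[of ?o "v + w"] v w
      by (intro defect_form_cong[OF x]) (simp_all add: add \<Gamma>_linear)
    thus "- defect_form x (lift ?o (v + w)) = - defect_form x (lift ?o v) + - defect_form x (lift ?o w)"
      using anti(1) lift(1)[OF o v] lift(1)[OF o w] by simp
  next
    fix v :: "complex Matrix.vec" and c assume v: "v \<in> carrier_vec p"
    have "defect_form x (lift ?o (c \<cdot>\<^sub>v v)) = defect_form x (c *\<^sub>C lift ?o v)"
      using lift[OF o v] lift[of ?o "c \<cdot>\<^sub>v v"] v
      by (intro defect_form_cong[OF x]) (simp_all add: scale \<Gamma>_linear co)
    thus "- defect_form x (lift ?o (c \<cdot>\<^sub>v v)) = cnj c * - defect_form x (lift ?o v)"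
      using anti(2) lift(1)[OF o v] by simp
  qed
  note c = \<Gamma>_linear(1,2)[OF y]
  have "defect_form x y = defect_form x (lift (\<Gamma>\<^sub>0 y) ?o + lift ?o (\<Gamma>\<^sub>1 y))"
    using lift[OF c(1) o] lift[OF o c(2)] c
    by (intro defect_form_cong[OF x y]) (simp_all add: add \<Gamma>_linear)
  thus ?thesis
    using 1[OF c(1)] 0[OF c(2)] anti(1) lift(1)[OF c(1) o] lift(1)[OF o c(2)] by (simp add: minus_equation_iff)
qed

text \<open>The representing vectors are unique because the boundary values of \<open>y\<close>
  range over all pairs of vectors.\<close>

lemma ext_\<Gamma>_eqI:
  assumes x: "x \<in> rig_rel A A" and "\<xi> \<in> carrier_vec p" "\<eta> \<in> carrier_vec p"
    and eq: "\<And>y. y \<in> rel_adj A \<Longrightarrow> defect_form x y = \<eta> \<bullet>c \<Gamma>\<^sub>0 y - \<xi> \<bullet>c \<Gamma>\<^sub>1 y"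
  shows "ext_\<Gamma>\<^sub>0 x = \<xi>" "ext_\<Gamma>\<^sub>1 x = \<eta>"
proof -
  have o: "(0\<^sub>v p :: complex Matrix.vec) \<in> carrier_vec p" by simp
  have e: "ext_\<Gamma>\<^sub>1 x \<bullet>c v - ext_\<Gamma>\<^sub>0 x \<bullet>c w = \<eta> \<bullet>c v - \<xi> \<bullet>c w"
    if "v \<in> carrier_vec p" "w \<in> carrier_vec p" for v w
    using defect_form_ext_\<Gamma>[OF x lift(1)[OF that]] eq[OF lift(1)[OF that]] lift(2,3)[OF that] by simp
  show "ext_\<Gamma>\<^sub>0 x = \<xi>"
    using e[OF o] assms(2,3) by (intro cscalar_prod_eqI[of _ p]) (simp_all add: ext_\<Gamma>_carrier[THEN carrier_vecD])
  show "ext_\<Gamma>\<^sub>1 x = \<eta>"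
    using e[OF _ o] assms(2,3) by (intro cscalar_prod_eqI[of _ p]) (simp_all add: ext_\<Gamma>_carrier[THEN carrier_vecD])
qed

section \<open>Kernels of the extended boundary maps\<close>

text \<open>On \<open>A\<^sub>0\<close> only the term with \<open>ext_\<Gamma>\<^sub>0\<close>
  survives, and \<open>\<Gamma>\<^sub>1\<close> maps \<open>A\<^sub>0\<close> onto the whole of
  \<open>carrier_vec p\<close>.\<close>

lemma kernel_ext_\<Gamma>\<^sub>0: "kernel_on (rig_rel A A) p ext_\<Gamma>\<^sub>0 = rig_rel A A\<^sub>0"
proof (intro equalityI subsetI)
  fix x assume x: "x \<in> kernel_on (rig_rel A A) p ext_\<Gamma>\<^sub>0"
  hence "defect_form x y = 0" if "y \<in> A\<^sub>0" for y
    using defect_form_ext_\<Gamma>[of x y] that \<Gamma>_linear(2)[of y] by (simp add: kernel_on_def)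
  thus "x \<in> rig_rel A A\<^sub>0" using x by (simp add: kernel_on_def mem_rig_rel)
next
  fix x assume x: "x \<in> rig_rel A A\<^sub>0"
  hence xA: "x \<in> rig_rel A A" using A_subset_A\<^sub>0 by (auto simp: mem_rig_rel)
  have "ext_\<Gamma>\<^sub>0 x = 0\<^sub>v p"
  proof (rule cscalar_prod_eqI[of _ p])
    fix \<eta> :: "complex Matrix.vec" assume \<eta>: "\<eta> \<in> carrier_vec p"
    note y = lift[OF zero_carrier_vec \<eta>]
    have "lift (0\<^sub>v p) \<eta> \<in> A\<^sub>0" using y by (simp add: kernel_on_def)
    hence "defect_form x (lift (0\<^sub>v p) \<eta>) = 0" using x by (simp only: mem_rig_rel)
    thus "ext_\<Gamma>\<^sub>0 x \<bullet>c \<eta> = 0\<^sub>v p \<bullet>c \<eta>"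
      using defect_form_ext_\<Gamma>[OF xA y(1)] y(2,3) \<eta> by (simp add: ext_\<Gamma>_carrier[THEN carrier_vecD])
  qed simp_all
  thus "x \<in> kernel_on (rig_rel A A) p ext_\<Gamma>\<^sub>0" using xA by (simp add: kernel_on_def)
qed

lemma kernel_ext_\<Gamma>:
  "kernel_on (rig_rel A A) p ext_\<Gamma>\<^sub>1 \<inter> kernel_on (rig_rel A A) p ext_\<Gamma>\<^sub>0 = rig_rel A (rel_adj A)"
proof (intro equalityI subsetI)
  fix x assume "x \<in> kernel_on (rig_rel A A) p ext_\<Gamma>\<^sub>1 \<inter> kernel_on (rig_rel A A) p ext_\<Gamma>\<^sub>0"
  hence x: "x \<in> rig_rel A A" "ext_\<Gamma>\<^sub>0 x = 0\<^sub>v p" "ext_\<Gamma>\<^sub>1 x = 0\<^sub>v p" by (auto simp: kernel_on_def)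
  have "defect_form x y = 0" if "y \<in> rel_adj A" for y
    using defect_form_ext_\<Gamma>[OF x(1) that] x(2,3) \<Gamma>_linear(1,2)[OF that] by simp
  thus "x \<in> rig_rel A (rel_adj A)" using x(1) by (simp add: mem_rig_rel)
next
  fix x assume x: "x \<in> rig_rel A (rel_adj A)"
  hence xA: "x \<in> rig_rel A A" using sym by (auto simp: mem_rig_rel)
  have "ext_\<Gamma>\<^sub>0 x = 0\<^sub>v p" "ext_\<Gamma>\<^sub>1 x = 0\<^sub>v p"
    using ext_\<Gamma>_eqI[OF xA zero_carrier_vec zero_carrier_vec] x \<Gamma>_linear(1,2)
    by (simp_all add: mem_rig_rel)
  thus "x \<in> kernel_on (rig_rel A A) p ext_\<Gamma>\<^sub>1 \<inter> kernel_on (rig_rel A A) p ext_\<Gamma>\<^sub>0"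
    using xA by (simp add: kernel_on_def)
qed

section \<open>Continuation property and resolvent formula\<close>

lemma defect_form_rig_pair:
  assumes "k \<in> rel_adj A"
  shows "defect_form (rig_pair A y) k = cinner (snd y) (fst k) - cinner (fst y) (snd k)"
  using fst_rel_adj_rig_plus[OF assms] by (simp add: defect_form_def rig_pair_def rig_embed_def)

lemma rig_pair_rel_adj:
  assumes "y \<in> rel_adj A"
  shows "rig_pair A y \<in> rig_rel A A"
  unfolding mem_rig_rel
proof
  show "snd (rig_pair A y) \<in> rig_minus A" by (simp add: rig_pair_def rig_embed_in_rig_minus[OF sub])
  show "\<forall>k\<in>A. defect_form (rig_pair A y) k = 0"
    using sym assms rel_adjD[of "fst y" "snd y" A] by (auto simp: defect_form_rig_pair subset_iff)
qed

lemma ext_\<Gamma>_rig_pair: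
  assumes "y \<in> rel_adj A"
  shows "ext_\<Gamma>\<^sub>0 (rig_pair A y) = \<Gamma>\<^sub>0 y" "ext_\<Gamma>\<^sub>1 (rig_pair A y) = \<Gamma>\<^sub>1 y"
  using ext_\<Gamma>_eqI[OF rig_pair_rel_adj[OF assms] \<Gamma>_linear(1,2)[OF assms]]
    defect_form_rig_pair green[OF assms] by simp_all

text \<open>The defining identity of the extended resolvent makes the form vanish on
  \<open>A\<^sub>0\<close>, which settles the first map; evaluating the form on the defect graph at
  \<open>cnj z\<close> identifies the second.\<close>

lemma ext_\<Gamma>_ext_resolvent:
  assumes z: "z \<in> resolvent_set A\<^sub>0" and \<phi>: "\<phi> \<in> rig_minus A"
  defines "r \<equiv> ext_resolvent A\<^sub>0 z \<phi>"
  shows "ext_\<Gamma>\<^sub>0 (r, \<phi> + rig_embed A (z *\<^sub>C r)) = 0\<^sub>v p"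
    "ext_\<Gamma>\<^sub>1 (r, \<phi> + rig_embed A (z *\<^sub>C r)) = gamma_adj A p \<Gamma>\<^sub>0 (cnj z) \<phi>"
proof -
  define x where "x = (r, \<phi> + rig_embed A (z *\<^sub>C r))"
  have w: "cnj z \<in> resolvent_set A\<^sub>0"
    by (rule selfadjoint_resolvent_set_cnj[OF A\<^sub>0_selfadjoint z])
  have form: "defect_form x y = \<phi> (fst y) - cinner r (snd y - cnj z *\<^sub>C fst y)"
    if "y \<in> rel_adj A" for y
    using fst_rel_adj_rig_plus[OF that]
    by (simp add: x_def defect_form_def rig_embed_def cinner_simps)
  have "defect_form x y = 0" if y: "y \<in> A\<^sub>0" for y
  proof -
    have "(fst y, snd y - cnj z *\<^sub>C fst y) \<in> rel_shift A\<^sub>0 (cnj z)"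
      using y by (intro rel_shiftI) simp
    from resolvent_eqI[OF csubspace_A\<^sub>0 w this] show ?thesis
      using form[of y] y ext_resolvent_eq[OF z \<phi>] by (simp add: r_def kernel_on_def)
  qed
  moreover have "snd x \<in> rig_minus A"
    using rig_minus_add[OF sub \<phi> rig_embed_in_rig_minus[OF sub]] by (simp add: x_def)
  ultimately have "x \<in> kernel_on (rig_rel A A) p ext_\<Gamma>\<^sub>0"
    unfolding kernel_ext_\<Gamma>\<^sub>0 by (simp add: mem_rig_rel)
  hence x: "x \<in> rig_rel A A" "ext_\<Gamma>\<^sub>0 x = 0\<^sub>v p" by (auto simp: kernel_on_def)
  \<comment> \<open>At the gamma-field element the inner product term of \<open>form\<close>
    vanishes, since its second component is \<open>cnj z\<close> times its first.\<close>
  have \<gamma>: "ext_\<Gamma>\<^sub>1 x \<bullet>c \<xi> = \<phi> (gamma_field A \<Gamma>\<^sub>0 (cnj z) \<xi>)" if \<xi>: "\<xi> \<in> carrier_vec p" for \<xi>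
  proof -
    note g = gamma_hat_props[OF w \<xi>]
    show ?thesis
      using form[OF g(2)] defect_form_ext_\<Gamma>[OF x(1) g(2)] x(2) g(1,3) \<Gamma>_linear(2)[OF g(2)] by simp
  qed
  have "gamma_adj A p \<Gamma>\<^sub>0 (cnj z) \<phi> = ext_\<Gamma>\<^sub>1 x"
    unfolding gamma_adj_def
  proof (rule the_equality)
    fix v assume v: "v \<in> carrier_vec p \<and> (\<forall>\<xi>\<in>carrier_vec p. v \<bullet>c \<xi> = \<phi> (gamma_field A \<Gamma>\<^sub>0 (cnj z) \<xi>))"
    show "v = ext_\<Gamma>\<^sub>1 x" using v \<gamma> by (intro cscalar_prod_eqI[of v p]) simp_all
  qed (use \<gamma> in simp)
  thus "ext_\<Gamma>\<^sub>0 (r, \<phi> + rig_embed A (z *\<^sub>C r)) = 0\<^sub>v p"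
    "ext_\<Gamma>\<^sub>1 (r, \<phi> + rig_embed A (z *\<^sub>C r)) = gamma_adj A p \<Gamma>\<^sub>0 (cnj z) \<phi>"
    using x(2) by (simp_all add: x_def)
qed

section \<open>Boundedness of the extension\<close>

lemma defect_form_bounded:
  assumes y: "y \<in> rel_adj A"
  obtains K where "K \<ge> 0" "\<And>x. x \<in> rig_rel A A \<Longrightarrow> cmod (defect_form x y) \<le> K * pair_norm A x"
proof
  let ?K = "1 + norm (fst y) + norm (snd y)"
  show "?K + norm (snd y) \<ge> 0" by simp
  fix x assume x: "x \<in> rig_rel A A"
  have "norm (fst x) \<le> pair_norm A x" "rig_minus_norm A (snd x) \<le> pair_norm A x"
    by (auto simp: pair_norm_def intro: real_le_rsqrt)
  moreover have "cmod (snd x (fst y)) \<le> ?K * rig_minus_norm A (snd x)"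
    using cmod_le_rig_minus_norm[OF sub, of "snd x" "fst y" "snd y"] x y by (simp add: mem_rig_rel)
  moreover have "cmod (cinner (fst x) (snd y)) \<le> norm (snd y) * norm (fst x)"
    using cmod_cinner_le[of "fst x" "snd y"] by (simp add: mult.commute)
  ultimately have "cmod (snd x (fst y)) \<le> ?K * pair_norm A x"
    "cmod (cinner (fst x) (snd y)) \<le> norm (snd y) * pair_norm A x"
    by (meson order_trans mult_left_mono add_nonneg_nonneg norm_ge_zero zero_le_one)+
  thus "cmod (defect_form x y) \<le> (?K + norm (snd y)) * pair_norm A x"
    using norm_triangle_ineq4[of "snd x (fst y)" "cinner (fst x) (snd y)"]
    by (simp add: defect_form_def distrib_right)
qed

lemma defect_form_linear:
  "defect_form (x + x') y = defect_form x y + defect_form x' y"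
  "defect_form (pair_scale c x) y = c * defect_form x y"
  by (simp_all add: defect_form_def pair_scale_def cinner_simps algebra_simps)

lemma bounded_map_ext_\<Gamma>: "bounded_map_on_rel A (2 * p) (col_map ext_\<Gamma>\<^sub>0 ext_\<Gamma>\<^sub>1)"
proof -
  let ?F = "col_map ext_\<Gamma>\<^sub>0 ext_\<Gamma>\<^sub>1"
  have carr: "?F x \<in> carrier_vec (2 * p)" for x
    unfolding col_map_def mult_2 by (intro append_carrier_vec) simp_all
  have add: "?F (x + y) = ?F x + ?F y" for x y
    by (intro eq_vecI) (auto simp: col_map_def ext_\<Gamma>\<^sub>0_def ext_\<Gamma>\<^sub>1_def defect_form_linear)
  have scale: "?F (pair_scale c x) = c \<cdot>\<^sub>v ?F x" for c x
    by (intro eq_vecI) (auto simp: col_map_def ext_\<Gamma>\<^sub>0_def ext_\<Gamma>\<^sub>1_def defect_form_linear)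
  have "\<exists>K. \<forall>x\<in>rig_rel A A. cmod (vec_index (?F x) i) \<le> K * pair_norm A x" if i: "i < 2 * p" for i
  proof -
    \<comment> \<open>Coordinate \<open>i\<close> is, up to sign, the form at this fixed element;
      the second block starts at index \<open>p\<close>, hence the shift.\<close>
    define y where "y = (if i < p then lift (0\<^sub>v p) (unit_vec p i) else lift (unit_vec p (i - p)) (0\<^sub>v p))"
    have "y \<in> rel_adj A" by (simp add: y_def lift)
    then obtain K where "\<And>x. x \<in> rig_rel A A \<Longrightarrow> cmod (defect_form x y) \<le> K * pair_norm A x"
      using defect_form_bounded by metis
    moreover have "cmod (vec_index (?F x) i) = cmod (defect_form x y)" for x
      using i by (auto simp: col_map_def ext_\<Gamma>\<^sub>0_def ext_\<Gamma>\<^sub>1_def y_def)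
    ultimately have "\<forall>x\<in>rig_rel A A. cmod (vec_index (?F x) i) \<le> K * pair_norm A x" by metis
    thus ?thesis by blast
  qed
  then obtain K where K:
    "\<And>i x. i < 2 * p \<Longrightarrow> x \<in> rig_rel A A \<Longrightarrow> cmod (vec_index (?F x) i) \<le> K i * pair_norm A x"
    by metis
  have "cvec_norm (?F x) \<le> (\<Sum>i<2 * p. K i) * pair_norm A x" if "x \<in> rig_rel A A" for x
  proof -
    have "cvec_norm (?F x) \<le> (\<Sum>i<2 * p. cmod (vec_index (?F x) i))"
      using cvec_norm_le_sum[of "?F x"] carr[of x] by simp
    also have "\<dots> \<le> (\<Sum>i<2 * p. K i * pair_norm A x)" using K that by (intro sum_mono) simp
    finally show ?thesis by (simp add: sum_distrib_right)
  qed
  hence "\<exists>C. \<forall>x\<in>rig_rel A A. cvec_norm (?F x) \<le> C * pair_norm A x" by blast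
  thus ?thesis using carr add scale by (simp add: bounded_map_on_rel_def linear_map_on_def)
qed

end

theorem lemma3p7:
  fixes A A\<^sub>0 :: "'h::chilbert_space linrel"
    and p :: nat
    and \<Gamma>\<^sub>0 \<Gamma>\<^sub>1 :: "'h \<times> 'h \<Rightarrow> complex Matrix.vec"
  assumes lin: "linear_relation A"
    and clo: "closed A"
    and sym: "A \<subseteq> rel_adj A"
    and def: "defect_numbers A p p"
    and bt: "boundary_triple A p \<Gamma>\<^sub>0 \<Gamma>\<^sub>1"
    and A0: "A\<^sub>0 = kernel_on (rel_adj A) p \<Gamma>\<^sub>0"
  shows "\<exists>\<Gamma>h\<^sub>0 \<Gamma>h\<^sub>1 :: 'h \<times> ('h \<Rightarrow> complex) \<Rightarrow> complex Matrix.vec.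
      (\<forall>x\<in>rig_rel A A. \<Gamma>h\<^sub>0 x \<in> carrier_vec p \<and> \<Gamma>h\<^sub>1 x \<in> carrier_vec p) \<and>
      bounded_map_on_rel A (2 * p) (col_map \<Gamma>h\<^sub>0 \<Gamma>h\<^sub>1) \<and>
      rig_pair A ` rel_adj A \<subseteq> rig_rel A A \<and>
      (\<forall>x\<in>rel_adj A. col_map \<Gamma>h\<^sub>0 \<Gamma>h\<^sub>1 (rig_pair A x) = col_map \<Gamma>\<^sub>0 \<Gamma>\<^sub>1 x) \<and>
      (\<forall>z\<in>resolvent_set A\<^sub>0.
        (\<forall>\<phi>\<in>rig_minus A.
          \<Gamma>h\<^sub>0 (ext_resolvent A\<^sub>0 z \<phi>, \<phi> + rig_embed A (z *\<^sub>C ext_resolvent A\<^sub>0 z \<phi>)) = 0\<^sub>v p \<and>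
          \<Gamma>h\<^sub>1 (ext_resolvent A\<^sub>0 z \<phi>, \<phi> + rig_embed A (z *\<^sub>C ext_resolvent A\<^sub>0 z \<phi>)) =
            gamma_adj A p \<Gamma>\<^sub>0 (cnj z) \<phi>) \<and>
        (\<forall>u\<in>carrier_vec p.
          col_map \<Gamma>h\<^sub>0 \<Gamma>h\<^sub>1 (rig_pair A (gamma_hat A \<Gamma>\<^sub>0 z u)) =
            col_map \<Gamma>\<^sub>0 \<Gamma>\<^sub>1 (gamma_hat A \<Gamma>\<^sub>0 z u))) \<and>
      kernel_on (rig_rel A A) p \<Gamma>h\<^sub>0 = rig_rel A A\<^sub>0 \<and>
      kernel_on (rig_rel A A) p \<Gamma>h\<^sub>1 \<inter> kernel_on (rig_rel A A) p \<Gamma>h\<^sub>0 = rig_rel A (rel_adj A)"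
proof -
  interpret symmetric_boundary_triple A p \<Gamma>\<^sub>0 \<Gamma>\<^sub>1
    using lin clo sym bt by unfold_locales (simp_all add: linear_relation_def)
  \<comment> \<open>This also yields the clause on \<open>gamma_hat\<close>, whose values lie in
    \<open>rel_adj A\<close>.\<close>
  have \<Gamma>: "col_map ext_\<Gamma>\<^sub>0 ext_\<Gamma>\<^sub>1 (rig_pair A y) = col_map \<Gamma>\<^sub>0 \<Gamma>\<^sub>1 y"
    if "y \<in> rel_adj A" for y
    by (simp add: col_map_def ext_\<Gamma>_rig_pair[OF that])
  show ?thesis
    unfolding A0
    by (rule exI[of _ ext_\<Gamma>\<^sub>0], rule exI[of _ ext_\<Gamma>\<^sub>1], intro conjI ballI)
      (simp_all add: bounded_map_ext_\<Gamma> image_subset_iff rig_pair_rel_adj \<Gamma>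
        ext_\<Gamma>_ext_resolvent gamma_hat_props(2) kernel_ext_\<Gamma>
        kernel_ext_\<Gamma>\<^sub>0[symmetric])
qed

end
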